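(* Let $T$ be a simple symplectic triple system over $\mathbb{R}$, with standard enveloping algebra $\mathfrak{g}(T)$ and Lie algebra of inner derivations $\mathfrak{inder}(T)$. Let $G$ be a Lie group and $H$ a closed connected subgroup of $G$ such that $(\mathrm{Lie}(G),\mathrm{Lie}(H))=(\mathfrak{g}(T),\mathfrak{inder}(T))$, and let $M=G/H$. Let $\mathfrak{m}=\mathfrak{sp}(V,\langle\cdot,\cdot\rangle)\oplus (V\otimes T)$, identified with the tangent space $T_oM$ at $o=eH$, and let $g$ be the $G$-invariant semi-Riemannian metric on $M$ determined at $o$ by $$g|_{\mathfrak{sp}(V)}=-\frac{1}{4(n+2)}\kappa,\qquad g|_{V\otimes T}=-\frac{1}{8(n+2)}\kappa,\qquad g|_{\mathfrak{sp}(V)\times (V\otimes T)}=0,$$ where $\kappa$ is the Killing form of $\mathfrak{g}(T)$ and $\dim T=2n$. Then $(M,g)$ is an Einstein manifold, since for all $X,Y\in\mathfrak{m}$, $$\mathrm{Ric}(X,Y)=(\dim M-1)\,g(X,Y).$$ Consequently, its scalar curvature is always positive, given by $$s^g=(\dim M-1)\dim M.$$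
   Context: All vector spaces are finite-dimensional. A (real) symplectic triple system is a real vector space $T$ with a non-zero alternating bilinear form $(\cdot,\cdot)\colon T\times T\to\mathbb{R}$ and a trilinear product $[\cdot,\cdot,\cdot]\colon T\times T\times T\to T$ such that for all $x,y,z,u,v,w\in T$: (1) $[x,y,z]=[y,x,z]$; (2) $[x,y,z]-[x,z,y]=(x,z)y-(x,y)z+2(y,z)x$; (3) $[x,y,[u,v,w]]=[[x,y,u],v,w]+[u,[x,y,v],w]+[u,v,[x,y,w]]$; (4) $([x,y,u],v)=-(u,[x,y,v])$. An ideal of $T$ is a subspace $I$ with $[T,T,I]+[T,I,T]\subset I$; $T$ is simple if $[T,T,T]\neq 0$ and it contains no proper (non-zero) ideal. (Simplicity is equivalent to non-degeneracy of $(\cdot,\cdot)$; in particular, $\dim T$ is then even.) For $x,y\in T$ put $d_{x,y}\colon T\to T$, $d_{x,y}(z)=[x,y,z]$. The algebra of inner derivations $\mathfrak{inder}(T)$ is the linear span of all $d_{x,y}$, a Lie subalgebra of $\mathfrak{gl}(T)$. Let $V=\mathbb{R}e_1\oplus\mathbb{R}e_2$ with the alternating bilinear form $\langle\cdot,\cdot\rangle$ given by $\langle e_1,e_2\rangle=1$; $\mathfrak{sp}(V)=\mathfrak{sp}(V,\langle\cdot,\cdot\rangle)=\{\gamma\in\mathfrak{gl}(V):\langle\gamma(a),b\rangle+\langle a,\gamma(b)\rangle=0\ \forall a,b\in V\}$; and $\gamma_{a,b}:=\langle a,\cdot\rangle b+\langle b,\cdot\rangle a\in\mathfrak{sp}(V)$.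 The standard enveloping algebra is the Lie algebra $\mathfrak{g}(T)=\mathfrak{sp}(V)\oplus\mathfrak{inder}(T)\oplus (V\otimes T)$ with skew-symmetric bracket determined by $[\gamma+d,\gamma'+d']=[\gamma,\gamma']+[d,d']$, $[\gamma+d,a\otimes x]=\gamma(a)\otimes x+a\otimes d(x)$, $[a\otimes x,b\otimes y]=(x,y)\gamma_{a,b}+\langle a,b\rangle d_{x,y}$, for $\gamma,\gamma'\in\mathfrak{sp}(V)$, $d,d'\in\mathfrak{inder}(T)$, $a,b\in V$, $x,y\in T$. With $\mathfrak{h}=\mathfrak{inder}(T)$ and $\mathfrak{m}=\mathfrak{sp}(V)\oplus (V\otimes T)$, one has the reductive decomposition $\mathfrak{g}(T)=\mathfrak{h}\oplus\mathfrak{m}$. The tangent space $T_oM$ is identified with $\mathfrak{m}$ via the restriction to $\mathfrak m$ of the differential at $e$ of the projection $\pi\colon G\to G/H$. Write $[X,Y]_{\mathfrak{h}}$, $[X,Y]_{\mathfrak{m}}$ for the projections of $[X,Y]$ onto $\mathfrak{h}$, $\mathfrak{m}$. The Levi-Civita connection of $g$ corresponds to the unique $\mathfrak{h}$-invariant bilinear map $\alpha^g\colon\mathfrak{m}\times\mathfrak{m}\to\mathfrak{m}$ with $\alpha^g(X,Y)-\alpha^g(Y,X)=[X,Y]_{\mathfrak{m}}$ and $g(\alpha^g(X,Y),Z)+g(Y,\alpha^g(X,Z))=0$ for all $X,Y,Z\in\mathfrak{m}$. The curvature tensor at $o$ is $R(X,Y)Z=\alpha^g(X,\alpha^g(Y,Z))-\alpha^g(Y,\alpha^g(X,Z))-\alpha^g([X,Y]_{\mathfrak{m}},Z)-[[X,Y]_{\mathfrak{h}},Z]$.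 The Ricci tensor is $\mathrm{Ric}(X,Y)=\operatorname{tr}(Z\mapsto R(Z,X)Y)$, and $s^g$ is the trace of $\mathrm{Ric}$ with respect to $g$. A semi-Riemannian manifold is Einstein if its Ricci tensor is a constant multiple of the metric. *)

theory Defs
  imports "HOL-Analysis.Analysis"
begin

section \<open>Symplectic triple systems\<close>

text \<open>The finite-dimensional real vector space \<open>T\<close> is an arbitrary type of class
  \<open>euclidean_space\<close>; the inner product of that class never enters. The alternating form is
  \<open>om\<close>, the triple product is \<open>tp\<close>.\<close>

locale symplectic_triple_system =
  fixes om :: "'t::euclidean_space \<Rightarrow> 't \<Rightarrow> real"
    and tp :: "'t \<Rightarrow> 't \<Rightarrow> 't \<Rightarrow> 't"
  assumes om_bilinear: "bilinear om"
    and om_alternating: "om x x = 0"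
    and om_nonzero: "\<exists>x y. om x y \<noteq> 0"
    and tp_linear1: "linear (\<lambda>x. tp x y z)"
    and tp_linear2: "linear (\<lambda>y. tp x y z)"
    and tp_linear3: "linear (\<lambda>z. tp x y z)"
    and tp_sym: "tp x y z = tp y x z"
    and tp_swap: "tp x y z - tp x z y
          = om x z *\<^sub>R y - om x y *\<^sub>R z + (2 * om y z) *\<^sub>R x"
    and tp_derivation: "tp x y (tp u v w)
          = tp (tp x y u) v w + tp u (tp x y v) w + tp u v (tp x y w)"
    and om_invariant: "om (tp x y u) v = - om u (tp x y v)"

definition sts_ideal :: "('t::euclidean_space \<Rightarrow> 't \<Rightarrow> 't \<Rightarrow> 't) \<Rightarrow> 't set \<Rightarrow> bool" where
  "sts_ideal tp I \<longleftrightarrow> subspace I \<and> (\<forall>x y. \<forall>z\<in>I. tp x y z \<in> I \<and> tp x z y \<in> I)"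

definition simple_sts ::
  "('t::euclidean_space \<Rightarrow> 't \<Rightarrow> real) \<Rightarrow> ('t \<Rightarrow> 't \<Rightarrow> 't \<Rightarrow> 't) \<Rightarrow> bool" where
  "simple_sts om tp \<longleftrightarrow> symplectic_triple_system om tp
     \<and> (\<exists>x y z. tp x y z \<noteq> 0)
     \<and> (\<forall>I. sts_ideal tp I \<longrightarrow> I = {0} \<or> I = UNIV)"


section \<open>The standard enveloping algebra\<close>

text \<open>\<open>V\<close> is \<open>real^2\<close>. Endomorphisms are bounded linear maps (automatic in finite dimension), so
  that they form a real vector space. \<open>V \<otimes> T\<close> is modelled by \<open>T^2\<close>:
  a vector \<open>w\<close> stands for the sum of \<open>e\<^sub>i \<otimes> (w $ i)\<close> over \<open>i = 1, 2\<close>.\<close>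

definition symp2 :: "real^2 \<Rightarrow> real^2 \<Rightarrow> real" where
  "symp2 a b = a $ 1 * b $ 2 - a $ 2 * b $ 1"

definition spV :: "((real^2) \<Rightarrow>\<^sub>L (real^2)) set" where
  "spV = {\<gamma>. \<forall>a b. symp2 (blinfun_apply \<gamma> a) b + symp2 a (blinfun_apply \<gamma> b) = 0}"

definition gam :: "real^2 \<Rightarrow> real^2 \<Rightarrow> (real^2) \<Rightarrow>\<^sub>L (real^2)" where
  "gam a b = Blinfun (\<lambda>c. symp2 a c *\<^sub>R b + symp2 b c *\<^sub>R a)"

definition inner_der ::
  "('t::euclidean_space \<Rightarrow> 't \<Rightarrow> 't \<Rightarrow> 't) \<Rightarrow> 't \<Rightarrow> 't \<Rightarrow> 't \<Rightarrow>\<^sub>L 't" where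
  "inner_der tp x y = Blinfun (\<lambda>z. tp x y z)"

definition inder :: "('t::euclidean_space \<Rightarrow> 't \<Rightarrow> 't \<Rightarrow> 't) \<Rightarrow> ('t \<Rightarrow>\<^sub>L 't) set" where
  "inder tp = span {inner_der tp x y | x y. True}"

definition tens :: "real^2 \<Rightarrow> 't::euclidean_space \<Rightarrow> 't^2" where
  "tens a x = (\<chi> i. (a $ i) *\<^sub>R x)"

text \<open>A triple \<open>(\<gamma>, d, w)\<close> stands for \<open>\<gamma> + d + w\<close>.\<close>

type_synonym 't envel = "((real^2) \<Rightarrow>\<^sub>L (real^2)) \<times> ('t \<Rightarrow>\<^sub>L 't) \<times> ('t^2)"

definition act_sp :: "((real^2) \<Rightarrow>\<^sub>L (real^2)) \<Rightarrow> 't::euclidean_space^2 \<Rightarrow> 't^2" where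
  "act_sp \<gamma> w = (\<Sum>i\<in>UNIV. tens (blinfun_apply \<gamma> (axis i 1)) (w $ i))"

definition act_der :: "('t \<Rightarrow>\<^sub>L 't) \<Rightarrow> 't::euclidean_space^2 \<Rightarrow> 't^2" where
  "act_der d w = (\<chi> i. blinfun_apply d (w $ i))"

fun bracket :: "('t::euclidean_space \<Rightarrow> 't \<Rightarrow> real) \<Rightarrow> ('t \<Rightarrow> 't \<Rightarrow> 't \<Rightarrow> 't)
    \<Rightarrow> 't envel \<Rightarrow> 't envel \<Rightarrow> 't envel" where
  "bracket om tp (\<gamma>, d, w) (\<gamma>', d', w') =
     ((\<gamma> o\<^sub>L \<gamma>') - (\<gamma>' o\<^sub>L \<gamma>)
        + (\<Sum>i\<in>UNIV. \<Sum>j\<in>UNIV. om (w $ i) (w' $ j) *\<^sub>R gam (axis i 1) (axis j 1)),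
      (d o\<^sub>L d') - (d' o\<^sub>L d)
        + (\<Sum>i\<in>UNIV. \<Sum>j\<in>UNIV. symp2 (axis i 1) (axis j 1) *\<^sub>R inner_der tp (w $ i) (w' $ j)),
      act_sp \<gamma> w' + act_der d w' - act_sp \<gamma>' w - act_der d' w)"

definition envel_space :: "('t::euclidean_space \<Rightarrow> 't \<Rightarrow> 't \<Rightarrow> 't) \<Rightarrow> 't envel set" where
  "envel_space tp = {(\<gamma>, d, w) | \<gamma> d w. \<gamma> \<in> spV \<and> d \<in> inder tp}"

definition h_space :: "('t::euclidean_space \<Rightarrow> 't \<Rightarrow> 't \<Rightarrow> 't) \<Rightarrow> 't envel set" where
  "h_space tp = {(0, d, 0) | d. d \<in> inder tp}"

definition m_space :: "'t::euclidean_space envel set" where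
  "m_space = {(\<gamma>, 0, w) | \<gamma> w. \<gamma> \<in> spV}"

fun proj_h :: "'t::euclidean_space envel \<Rightarrow> 't envel" where
  "proj_h (\<gamma>, d, w) = (0, d, 0)"

fun proj_m :: "'t::euclidean_space envel \<Rightarrow> 't envel" where
  "proj_m (\<gamma>, d, w) = (\<gamma>, 0, w)"

text \<open>The defining formulas of the bracket on pure tensors.\<close>

lemma bounded_linear_gam:
  "bounded_linear (\<lambda>c. symp2 a c *\<^sub>R b + symp2 b c *\<^sub>R a)"
  by (rule linear_conv_bounded_linear[THEN iffD1], rule linearI)
    (auto simp: symp2_def algebra_simps vec_eq_iff)

lemma gam_apply: "blinfun_apply (gam a b) c = symp2 a c *\<^sub>R b + symp2 b c *\<^sub>R a"
  unfolding gam_def by (simp add: bounded_linear_Blinfun_apply bounded_linear_gam)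

lemma vec2_expand: "(a::real^2) = a $ 1 *\<^sub>R axis 1 1 + a $ 2 *\<^sub>R axis 2 1"
  by (simp add: vec_eq_iff forall_2 axis_def)

lemma act_sp_tens: "act_sp \<gamma> (tens a x) = tens (blinfun_apply \<gamma> a) x"
proof -
  have "blinfun_apply \<gamma> a
      = a $ 1 *\<^sub>R blinfun_apply \<gamma> (axis 1 1) + a $ 2 *\<^sub>R blinfun_apply \<gamma> (axis 2 1)"
    by (subst vec2_expand[of a]) (simp add: blinfun.add_right blinfun.scaleR_right)
  then show ?thesis
    by (simp add: act_sp_def tens_def sum_2 vec_eq_iff scaleR_add_left mult.commute)
qed

lemma act_der_tens: "act_der d (tens a x) = tens a (blinfun_apply d x)"
  by (simp add: act_der_def tens_def blinfun.scaleR_right)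

context symplectic_triple_system
begin

lemma inner_der_apply: "blinfun_apply (inner_der tp x y) z = tp x y z"
  unfolding inner_der_def
  by (simp add: bounded_linear_Blinfun_apply linear_conv_bounded_linear[THEN iffD1] tp_linear3)

lemma bracket_even:
  "bracket om tp (\<gamma>, d, 0) (\<gamma>', d', 0)
     = ((\<gamma> o\<^sub>L \<gamma>') - (\<gamma>' o\<^sub>L \<gamma>), (d o\<^sub>L d') - (d' o\<^sub>L d), 0)"
proof -
  have "inner_der tp 0 0 = 0"
    by (rule blinfun_eqI) (simp add: inner_der_apply linear_0[OF tp_linear1])
  then show ?thesis
    by (simp add: bilinear_lzero[OF om_bilinear] act_sp_def act_der_def tens_def vec_eq_iff)
qed

lemma bracket_even_odd:
  "bracket om tp (\<gamma>, d, 0) (0, 0, tens a x)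
     = (0, 0, tens (blinfun_apply \<gamma> a) x + tens a (blinfun_apply d x))"
proof -
  have "inner_der tp 0 y = 0" for y
    by (rule blinfun_eqI) (simp add: inner_der_apply linear_0[OF tp_linear1])
  moreover have "act_sp 0 w = 0" "act_der 0 w = 0" for w :: "'t^2"
    by (simp_all add: act_sp_def act_der_def tens_def vec_eq_iff)
  ultimately show ?thesis
    by (simp add: bilinear_lzero[OF om_bilinear] act_sp_tens act_der_tens)
qed

lemma bracket_odd:
  "bracket om tp (0, 0, tens a x) (0, 0, tens b y)
     = (om x y *\<^sub>R gam a b, symp2 a b *\<^sub>R inner_der tp x y, 0)"
proof -
  have *: "inner_der tp (r *\<^sub>R x) (s *\<^sub>R y) = (r * s) *\<^sub>R inner_der tp x y" for r s
    by (rule blinfun_eqI)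
      (simp add: inner_der_apply blinfun.scaleR_left linear_scale[OF tp_linear1]
        linear_scale[OF tp_linear2])
  have "(\<Sum>i\<in>UNIV. \<Sum>j\<in>UNIV. om (tens a x $ i) (tens b y $ j) *\<^sub>R gam (axis i 1) (axis j 1))
      = om x y *\<^sub>R gam a b"
    by (rule blinfun_eqI)
      (simp add: tens_def sum_2 bilinear_lmul[OF om_bilinear] bilinear_rmul[OF om_bilinear]
        blinfun.add_left blinfun.scaleR_left gam_apply symp2_def vec_eq_iff forall_2 axis_def
        algebra_simps)
  moreover have "(\<Sum>i\<in>UNIV. \<Sum>j\<in>UNIV. symp2 (axis i 1) (axis j 1)
        *\<^sub>R inner_der tp (tens a x $ i) (tens b y $ j)) = symp2 a b *\<^sub>R inner_der tp x y"
    by (simp add: tens_def sum_2 * symp2_def axis_def algebra_simps)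
  moreover have "act_sp 0 w = 0" "act_der 0 w = 0" for w :: "'t^2"
    by (simp_all add: act_sp_def act_der_def tens_def vec_eq_iff)
  ultimately show ?thesis by simp
qed

end

text \<open>Trace of an endomorphism of the subspace \<open>S\<close>, computed in a basis of \<open>S\<close>.\<close>

definition trace_on :: "'a::real_vector set \<Rightarrow> ('a \<Rightarrow> 'a) \<Rightarrow> real" where
  "trace_on S F = (let B = (SOME B. independent B \<and> span B = S)
     in \<Sum>b\<in>B. representation B (F b) b)"

definition killing :: "('t::euclidean_space \<Rightarrow> 't \<Rightarrow> real) \<Rightarrow> ('t \<Rightarrow> 't \<Rightarrow> 't \<Rightarrow> 't)
    \<Rightarrow> 't envel \<Rightarrow> 't envel \<Rightarrow> real" where
  "killing om tp X Y = trace_on (envel_space tp) (\<lambda>Z. bracket om tp X (bracket om tp Y Z))"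


section \<open>Levi-Civita connection and curvature at the base point\<close>

text \<open>Here \<open>go\<close> is the metric at the base point, as a bilinear form on \<open>\<mm>\<close>. The value \<open>0\<close>
  outside \<open>\<mm> \<times> \<mm>\<close> only serves to make \<open>\<alpha>\<close> unique as a total function.\<close>

definition levi_civita_map :: "('t::euclidean_space \<Rightarrow> 't \<Rightarrow> real) \<Rightarrow> ('t \<Rightarrow> 't \<Rightarrow> 't \<Rightarrow> 't)
    \<Rightarrow> ('t envel \<Rightarrow> 't envel \<Rightarrow> real) \<Rightarrow> ('t envel \<Rightarrow> 't envel \<Rightarrow> 't envel) \<Rightarrow> bool" where
  "levi_civita_map om tp go \<alpha> \<longleftrightarrow>
     (\<forall>X Y. X \<notin> m_space \<or> Y \<notin> m_space \<longrightarrow> \<alpha> X Y = 0) \<and>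
     (\<forall>X\<in>m_space. \<forall>Y\<in>m_space. \<alpha> X Y \<in> m_space) \<and>
     (\<forall>X\<in>m_space. \<forall>Y\<in>m_space. \<forall>Z\<in>m_space. \<forall>r s.
        \<alpha> (r *\<^sub>R X + s *\<^sub>R Y) Z = r *\<^sub>R \<alpha> X Z + s *\<^sub>R \<alpha> Y Z \<and>
        \<alpha> Z (r *\<^sub>R X + s *\<^sub>R Y) = r *\<^sub>R \<alpha> Z X + s *\<^sub>R \<alpha> Z Y) \<and>
     (\<forall>D\<in>h_space tp. \<forall>X\<in>m_space. \<forall>Y\<in>m_space.
        bracket om tp D (\<alpha> X Y) = \<alpha> (bracket om tp D X) Y + \<alpha> X (bracket om tp D Y)) \<and>
     (\<forall>X\<in>m_space. \<forall>Y\<in>m_space. \<alpha> X Y - \<alpha> Y X = proj_m (bracket om tp X Y)) \<and>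
     (\<forall>X\<in>m_space. \<forall>Y\<in>m_space. \<forall>Z\<in>m_space. go (\<alpha> X Y) Z + go Y (\<alpha> X Z) = 0)"

definition lc_map :: "('t::euclidean_space \<Rightarrow> 't \<Rightarrow> real) \<Rightarrow> ('t \<Rightarrow> 't \<Rightarrow> 't \<Rightarrow> 't)
    \<Rightarrow> ('t envel \<Rightarrow> 't envel \<Rightarrow> real) \<Rightarrow> 't envel \<Rightarrow> 't envel \<Rightarrow> 't envel" where
  "lc_map om tp go = (THE \<alpha>. levi_civita_map om tp go \<alpha>)"

definition curvature_o :: "('t::euclidean_space \<Rightarrow> 't \<Rightarrow> real) \<Rightarrow> ('t \<Rightarrow> 't \<Rightarrow> 't \<Rightarrow> 't)
    \<Rightarrow> ('t envel \<Rightarrow> 't envel \<Rightarrow> real) \<Rightarrow> 't envel \<Rightarrow> 't envel \<Rightarrow> 't envel \<Rightarrow> 't envel" where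
  "curvature_o om tp go X Y Z = (let \<alpha> = lc_map om tp go in
     \<alpha> X (\<alpha> Y Z) - \<alpha> Y (\<alpha> X Z) - \<alpha> (proj_m (bracket om tp X Y)) Z
       - bracket om tp (proj_h (bracket om tp X Y)) Z)"

definition ricci_o :: "('t::euclidean_space \<Rightarrow> 't \<Rightarrow> real) \<Rightarrow> ('t \<Rightarrow> 't \<Rightarrow> 't \<Rightarrow> 't)
    \<Rightarrow> ('t envel \<Rightarrow> 't envel \<Rightarrow> real) \<Rightarrow> 't envel \<Rightarrow> 't envel \<Rightarrow> real" where
  "ricci_o om tp go X Y = trace_on m_space (\<lambda>Z. curvature_o om tp go Z X Y)"


section \<open>Smooth manifolds and Lie groups\<close>

primrec Ck_on :: "nat \<Rightarrow> 'a::euclidean_space set \<Rightarrow> ('a \<Rightarrow> 'b::real_normed_vector) \<Rightarrow> bool" where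
  "Ck_on 0 S f \<longleftrightarrow> continuous_on S f"
| "Ck_on (Suc k) S f \<longleftrightarrow> (\<forall>x\<in>S. f differentiable (at x))
     \<and> (\<forall>v. Ck_on k S (\<lambda>x. frechet_derivative f (at x) v))"

definition smooth_on :: "'a::euclidean_space set \<Rightarrow> ('a \<Rightarrow> 'b::real_normed_vector) \<Rightarrow> bool" where
  "smooth_on S f \<longleftrightarrow> open S \<and> (\<forall>k. Ck_on k S f)"

text \<open>A chart is a pair of its domain and the coordinate map (relevant only on the domain).\<close>

type_synonym ('m, 'e) chart = "'m set \<times> ('m \<Rightarrow> 'e)"

definition is_chart :: "('m::topological_space, 'e::euclidean_space) chart \<Rightarrow> bool" where
  "is_chart c \<longleftrightarrow> open (fst c) \<and> open (snd c ` fst c)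
     \<and> homeomorphism (fst c) (snd c ` fst c) (snd c) (inv_into (fst c) (snd c))"

definition chart_inv :: "('m, 'e) chart \<Rightarrow> 'e \<Rightarrow> 'm" where
  "chart_inv c = inv_into (fst c) (snd c)"

definition smooth_atlas :: "('m::topological_space, 'e::euclidean_space) chart set \<Rightarrow> bool" where
  "smooth_atlas A \<longleftrightarrow> (\<forall>c\<in>A. is_chart c) \<and> (\<Union>c\<in>A. fst c) = UNIV
     \<and> (\<forall>c\<in>A. \<forall>c'\<in>A. smooth_on (snd c ` (fst c \<inter> fst c')) (snd c' \<circ> chart_inv c))"

definition std_atlas :: "('e::euclidean_space, 'e) chart set" where
  "std_atlas = {(UNIV, id)}"

definition prod_atlas :: "('m, 'e) chart set \<Rightarrow> ('n, 'f) chart set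
    \<Rightarrow> ('m \<times> 'n, 'e \<times> 'f) chart set" where
  "prod_atlas A B = {(fst c \<times> fst d, map_prod (snd c) (snd d)) | c d. c \<in> A \<and> d \<in> B}"

definition smooth_map_on ::
  "('m::topological_space, 'e::euclidean_space) chart set
    \<Rightarrow> ('n::topological_space, 'f::euclidean_space) chart set \<Rightarrow> 'm set \<Rightarrow> ('m \<Rightarrow> 'n) \<Rightarrow> bool" where
  "smooth_map_on A B W F \<longleftrightarrow> open W \<and> continuous_on W F
     \<and> (\<forall>c\<in>A. \<forall>d\<in>B. smooth_on (snd c ` (fst c \<inter> W \<inter> F -` fst d)) (snd d \<circ> F \<circ> chart_inv c))"

definition smooth_at ::
  "('m::topological_space, 'e::euclidean_space) chart set \<Rightarrow> 'm \<Rightarrow> ('m \<Rightarrow> real) \<Rightarrow> bool" where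
  "smooth_at A p f \<longleftrightarrow> (\<exists>W. p \<in> W \<and> smooth_map_on A std_atlas W f)"

text \<open>A tangent vector at \<open>p\<close> is the directional derivative it induces on real functions that are
  smooth near \<open>p\<close> (with value \<open>0\<close> on all other functions); \<open>coord_vec A c p u\<close> is the one with
  coordinates \<open>u\<close> in the chart \<open>c\<close>.\<close>

type_synonym 'm tangent = "('m \<Rightarrow> real) \<Rightarrow> real"

definition coord_vec :: "('m::topological_space, 'e::euclidean_space) chart set
    \<Rightarrow> ('m, 'e) chart \<Rightarrow> 'm \<Rightarrow> 'e \<Rightarrow> 'm tangent" where
  "coord_vec A c p u = (\<lambda>f. if smooth_at A p f
     then frechet_derivative (f \<circ> chart_inv c) (at (snd c p)) u else 0)"

definition tangent_space :: "('m::topological_space, 'e::euclidean_space) chart set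
    \<Rightarrow> 'm \<Rightarrow> 'm tangent set" where
  "tangent_space A p = {coord_vec A c p u | c u. c \<in> A \<and> p \<in> fst c}"

text \<open>The differential at \<open>p\<close> of a map \<open>F\<close> with \<open>F p = q\<close>, where \<open>B\<close> is an atlas of the
  target.\<close>

definition differential :: "('n::topological_space, 'f::euclidean_space) chart set
    \<Rightarrow> 'n \<Rightarrow> ('m \<Rightarrow> 'n) \<Rightarrow> 'm tangent \<Rightarrow> 'n tangent" where
  "differential B q F v = (\<lambda>f. if smooth_at B q f then v (f \<circ> F) else 0)"

text \<open>Groups are written additively, since \<open>group_add\<close> is the library's class of (not
  necessarily commutative) groups; \<open>0\<close> is the identity \<open>e\<close>.\<close>

definition lie_group :: "('g::{topological_group_add, t2_space, second_countable_topology},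
    'd::euclidean_space) chart set \<Rightarrow> bool" where
  "lie_group A \<longleftrightarrow> smooth_atlas A
     \<and> smooth_map_on (prod_atlas A A) A UNIV (\<lambda>(a, b). a + b)
     \<and> smooth_map_on A A UNIV uminus"

text \<open>The Lie algebra of \<open>G\<close> is the tangent space at the identity. A tangent vector \<open>Y\<close> extends
  to the left-invariant vector field whose derivative of \<open>f\<close> at \<open>a\<close> is \<open>Y (\<lambda>b. f (a + b))\<close>; the
  bracket is the commutator of these fields, evaluated at the identity.\<close>

definition lie_bracket :: "('g::{topological_group_add, t2_space, second_countable_topology},
    'd::euclidean_space) chart set \<Rightarrow> 'g tangent \<Rightarrow> 'g tangent \<Rightarrow> 'g tangent" where
  "lie_bracket A X Y = (\<lambda>f. if smooth_at A 0 f
     then X (\<lambda>a. Y (\<lambda>b. f (a + b))) - Y (\<lambda>a. X (\<lambda>b. f (a + b))) else 0)"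

definition is_subgroup :: "'g::group_add set \<Rightarrow> bool" where
  "is_subgroup H \<longleftrightarrow> 0 \<in> H \<and> (\<forall>a\<in>H. \<forall>b\<in>H. a + b \<in> H) \<and> (\<forall>a\<in>H. - a \<in> H)"

text \<open>The Lie algebra of a closed (hence embedded) subgroup \<open>H\<close>, as a subspace of the Lie algebra
  of \<open>G\<close>: initial velocities of smooth curves in \<open>H\<close> through the identity.\<close>

definition lie_subgroup_algebra ::
  "('g::{topological_group_add, t2_space, second_countable_topology},
    'd::euclidean_space) chart set \<Rightarrow> 'g set \<Rightarrow> 'g tangent set" where
  "lie_subgroup_algebra A H = {\<lambda>f. if smooth_at A 0 f then deriv (f \<circ> c) 0 else 0 | c :: real \<Rightarrow> 'g.
     smooth_map_on std_atlas A UNIV c \<and> c 0 = 0 \<and> range c \<subseteq> H}"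

text \<open>The identification of the pair of Lie algebras of \<open>(G, H)\<close> with the pair formed by the
  standard enveloping algebra and the inner derivations.\<close>

definition lie_pair_iso :: "('t::euclidean_space \<Rightarrow> 't \<Rightarrow> real) \<Rightarrow> ('t \<Rightarrow> 't \<Rightarrow> 't \<Rightarrow> 't)
    \<Rightarrow> ('g::{topological_group_add, t2_space, second_countable_topology},
        'd::euclidean_space) chart set \<Rightarrow> 'g set \<Rightarrow> ('t envel \<Rightarrow> 'g tangent) \<Rightarrow> bool" where
  "lie_pair_iso om tp A H \<Phi> \<longleftrightarrow>
     bij_betw \<Phi> (envel_space tp) (tangent_space A 0)
     \<and> (\<forall>X\<in>envel_space tp. \<forall>Y\<in>envel_space tp. \<Phi> (X + Y) = (\<lambda>f. \<Phi> X f + \<Phi> Y f))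
     \<and> (\<forall>X\<in>envel_space tp. \<forall>r. \<Phi> (r *\<^sub>R X) = (\<lambda>f. r * \<Phi> X f))
     \<and> (\<forall>X\<in>envel_space tp. \<forall>Y\<in>envel_space tp.
          \<Phi> (bracket om tp X Y) = lie_bracket A (\<Phi> X) (\<Phi> Y))
     \<and> \<Phi> ` h_space tp = lie_subgroup_algebra A H"


section \<open>The homogeneous space and its invariant metrics\<close>

text \<open>\<open>M = G/H\<close> is a type \<open>'m\<close> with a surjection \<open>\<pi>\<close> whose fibres are exactly the left cosets of
  \<open>H\<close>. Its smooth structure is the unique one for which \<open>\<pi>\<close> is smooth and admits smooth local
  sections.\<close>

definition homogeneous_space ::
  "('g::{topological_group_add, t2_space, second_countable_topology}, 'd::euclidean_space) chart set
    \<Rightarrow> 'g set \<Rightarrow> ('m::{t2_space, second_countable_topology}, 'e::euclidean_space) chart set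
    \<Rightarrow> ('g \<Rightarrow> 'm) \<Rightarrow> bool" where
  "homogeneous_space AG H AM \<pi> \<longleftrightarrow> smooth_atlas AM \<and> surj \<pi>
     \<and> (\<forall>a b. \<pi> a = \<pi> b \<longleftrightarrow> - a + b \<in> H)
     \<and> smooth_map_on AG AM UNIV \<pi>
     \<and> (\<forall>p. \<exists>W s. p \<in> W \<and> smooth_map_on AM AG W s \<and> (\<forall>q\<in>W. \<pi> (s q) = q))"

text \<open>The action of \<open>a \<in> G\<close> on \<open>M\<close>, \<open>bH \<mapsto> abH\<close>.\<close>

definition translate :: "('g::group_add \<Rightarrow> 'm) \<Rightarrow> 'g \<Rightarrow> 'm \<Rightarrow> 'm" where
  "translate \<pi> a p = \<pi> (a + inv \<pi> p)"

definition metric_comp :: "('m::topological_space, 'e::euclidean_space) chart set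
    \<Rightarrow> ('m \<Rightarrow> 'm tangent \<Rightarrow> 'm tangent \<Rightarrow> real) \<Rightarrow> ('m, 'e) chart \<Rightarrow> 'm \<Rightarrow> 'e \<Rightarrow> 'e \<Rightarrow> real" where
  "metric_comp A g c p u v = g p (coord_vec A c p u) (coord_vec A c p v)"

text \<open>Constancy of the index is not required separately: it is automatic for \<open>G\<close>-invariant
  metrics on \<open>G/H\<close>.\<close>

definition semi_riemannian_metric :: "('m::topological_space, 'e::euclidean_space) chart set
    \<Rightarrow> ('m \<Rightarrow> 'm tangent \<Rightarrow> 'm tangent \<Rightarrow> real) \<Rightarrow> bool" where
  "semi_riemannian_metric A g \<longleftrightarrow> (\<forall>c\<in>A.
     (\<forall>p\<in>fst c. bilinear (metric_comp A g c p)
        \<and> (\<forall>u v. metric_comp A g c p u v = metric_comp A g c p v u)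
        \<and> (\<forall>u. (\<forall>v. metric_comp A g c p u v = 0) \<longrightarrow> u = 0))
     \<and> (\<forall>u v. smooth_on (snd c ` fst c) (\<lambda>x. metric_comp A g c (chart_inv c x) u v)))"

definition invariant_metric :: "('m::topological_space, 'e::euclidean_space) chart set
    \<Rightarrow> ('g::group_add \<Rightarrow> 'm) \<Rightarrow> ('m \<Rightarrow> 'm tangent \<Rightarrow> 'm tangent \<Rightarrow> real) \<Rightarrow> bool" where
  "invariant_metric A \<pi> g \<longleftrightarrow> (\<forall>a p. \<forall>u\<in>tangent_space A p. \<forall>v\<in>tangent_space A p.
     g (translate \<pi> a p) (differential A (translate \<pi> a p) (translate \<pi> a) u)
        (differential A (translate \<pi> a p) (translate \<pi> a) v) = g p u v)"

text \<open>The differential of \<open>\<pi>\<close> at the identity, precomposed with the identification \<open>\<Phi>\<close>; its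
  restriction to \<open>\<mm>\<close> identifies \<open>\<mm>\<close> with the tangent space at the base point
  \<open>\<pi> 0\<close>.\<close>

definition to_tangent :: "('m::topological_space, 'e::euclidean_space) chart set
    \<Rightarrow> ('g::group_add \<Rightarrow> 'm) \<Rightarrow> ('t::euclidean_space envel \<Rightarrow> 'g tangent) \<Rightarrow> 't envel \<Rightarrow> 'm tangent" where
  "to_tangent A \<pi> \<Phi> X = differential A (\<pi> 0) \<pi> (\<Phi> X)"

definition metric_at_o :: "('m::topological_space, 'e::euclidean_space) chart set
    \<Rightarrow> ('g::group_add \<Rightarrow> 'm) \<Rightarrow> ('t::euclidean_space envel \<Rightarrow> 'g tangent)
    \<Rightarrow> ('m \<Rightarrow> 'm tangent \<Rightarrow> 'm tangent \<Rightarrow> real) \<Rightarrow> 't envel \<Rightarrow> 't envel \<Rightarrow> real" where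
  "metric_at_o A \<pi> \<Phi> g X Y = g (\<pi> 0) (to_tangent A \<pi> \<Phi> X) (to_tangent A \<pi> \<Phi> Y)"

text \<open>The Ricci tensor field of the \<open>G\<close>-invariant metric \<open>g\<close>: the \<open>G\<close>-invariant tensor field whose
  value at the base point is \<open>ricci_o\<close>. A tangent vector at \<open>p = aH\<close> is moved to the base point by
  the translation by the inverse of \<open>a\<close>.\<close>

definition ricci_tensor :: "('m::topological_space, 'e::euclidean_space) chart set
    \<Rightarrow> ('g::group_add \<Rightarrow> 'm) \<Rightarrow> ('t::euclidean_space envel \<Rightarrow> 'g tangent)
    \<Rightarrow> ('t \<Rightarrow> 't \<Rightarrow> real) \<Rightarrow> ('t \<Rightarrow> 't \<Rightarrow> 't \<Rightarrow> 't)
    \<Rightarrow> ('m \<Rightarrow> 'm tangent \<Rightarrow> 'm tangent \<Rightarrow> real) \<Rightarrow> 'm \<Rightarrow> 'm tangent \<Rightarrow> 'm tangent \<Rightarrow> real" where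
  "ricci_tensor A \<pi> \<Phi> om tp g p u v =
     (let pull = (\<lambda>w. inv_into m_space (to_tangent A \<pi> \<Phi>)
                        (differential A (\<pi> 0) (translate \<pi> (- inv \<pi> p)) w))
      in ricci_o om tp (metric_at_o A \<pi> \<Phi> g) (pull u) (pull v))"

definition einstein :: "('m::topological_space, 'e::euclidean_space) chart set
    \<Rightarrow> ('m \<Rightarrow> 'm tangent \<Rightarrow> 'm tangent \<Rightarrow> real) \<Rightarrow> ('m \<Rightarrow> 'm tangent \<Rightarrow> 'm tangent \<Rightarrow> real) \<Rightarrow> bool" where
  "einstein A g Rc \<longleftrightarrow>
     (\<exists>k::real. \<forall>p. \<forall>u\<in>tangent_space A p. \<forall>v\<in>tangent_space A p. Rc p u v = k * g p u v)"

text \<open>The trace at \<open>p\<close> of a bilinear form \<open>S\<close> with respect to \<open>g\<close>, i.e. the trace of the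
  endomorphism \<open>Q\<close> with \<open>g (Q u) v = S u v\<close>, in a chart around \<open>p\<close>.\<close>

definition metric_trace :: "('m::topological_space, 'e::euclidean_space) chart set
    \<Rightarrow> ('m \<Rightarrow> 'm tangent \<Rightarrow> 'm tangent \<Rightarrow> real) \<Rightarrow> ('m \<Rightarrow> 'm tangent \<Rightarrow> 'm tangent \<Rightarrow> real)
    \<Rightarrow> 'm \<Rightarrow> real" where
  "metric_trace A g S p = (let c = (SOME c. c \<in> A \<and> p \<in> fst c) in
     trace_on UNIV (THE Q. linear Q \<and>
       (\<forall>u v. metric_comp A g c p (Q u) v = metric_comp A S c p u v)))"

definition scalar_curvature :: "('m::topological_space, 'e::euclidean_space) chart set
    \<Rightarrow> ('g::group_add \<Rightarrow> 'm) \<Rightarrow> ('t::euclidean_space envel \<Rightarrow> 'g tangent)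
    \<Rightarrow> ('t \<Rightarrow> 't \<Rightarrow> real) \<Rightarrow> ('t \<Rightarrow> 't \<Rightarrow> 't \<Rightarrow> 't)
    \<Rightarrow> ('m \<Rightarrow> 'm tangent \<Rightarrow> 'm tangent \<Rightarrow> real) \<Rightarrow> 'm \<Rightarrow> real" where
  "scalar_curvature A \<pi> \<Phi> om tp g = metric_trace A g (ricci_tensor A \<pi> \<Phi> om tp g)"

end

theory Submission
  imports Defs
begin

text \<open>Simplicity makes the form nondegenerate, so the traces of \<open>x \<mapsto> [y, x, z]\<close> on \<open>T\<close> follow from
  the axioms: the inner derivations are trace-free and (2) contributes a multiple of \<open>(y, z)\<close>. The
  Killing form is then \<open>2(n+2) tr(\<gamma>\<gamma>')\<close> on \<open>\<ss>\<pp>(V)\<close> and \<open>-4(n+2)\<langle>a,b\<rangle>(x,y)\<close> on \<open>V \<otimes> T\<close>; the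
  part of the trace running over \<open>\<ii>\<nn>\<dd>\<ee>\<rr>(T)\<close> is moved to \<open>T\<close> by cyclicity. Thus the metric is
  explicit and nondegenerate on \<open>\<mm>\<close>, the Levi-Civita map is given by the Koszul formula, and \<open>Ric\<close> is
  block diagonal with both blocks equal to \<open>4n+2\<close> times the metric. Finally \<open>d\<pi>\<close> maps \<open>\<mm>\<close>
  isomorphically onto the tangent space, so \<open>dim M = 4n+3\<close>, and translations carry the identity from
  the base point to all of \<open>M\<close>.\<close>

section \<open>Traces on subspaces\<close>

text \<open>\<open>trace_on\<close> uses an unknown basis, and the dimension of
  \<open>inder tp\<close> is never determined. Each trace is therefore evaluated through a
  resolution of the identity suited to the operator: the \<open>om\<close>-dual frame for skew maps,
  a standard basis of sl_2 for \<open>spV\<close>. The ratio 2 between the two normalisations is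
  what keeps the connection simple. For the metric -a \<kappa> on sp(V) and -b \<kappa> on V
  \<otimes> T, the Koszul formula gives (1 - a/(2b)) [\<gamma>, w] for the pair (\<gamma>, w), and
  this coefficient vanishes exactly at a = 2b. Since Ric is unchanged when the metric is rescaled,
  the remaining common factor only sets the Einstein constant. On the geometric side, tangent
  vectors are functionals on functions and translations are defined through an arbitrary choice of
  coset representatives. Linear algebra has to pass through chart coordinates, and smoothness of
  translations through local sections.\<close>

text \<open>Coordinates such as \<open>representation B\<close> vanish off the span of
  \<open>B\<close>, so they are linear on a subspace but in general not globally.\<close>

definition lin_on :: "'a::real_vector set \<Rightarrow> ('a \<Rightarrow> 'b::real_vector) \<Rightarrow> bool" where
  "lin_on S f \<longleftrightarrow> (\<forall>x\<in>S. \<forall>y\<in>S. \<forall>r s. f (r *\<^sub>R x + s *\<^sub>R y) = r *\<^sub>R f x + s *\<^sub>R f y)"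

lemma lin_on_linear: "linear f \<Longrightarrow> lin_on S f"
  by (simp add: lin_on_def linear_add linear_scale)

lemma lin_on_sum:
  assumes S: "subspace S" and f: "lin_on S f" and "finite I" and "\<And>i. i \<in> I \<Longrightarrow> b i \<in> S"
  shows "f (\<Sum>i\<in>I. r i *\<^sub>R b i) = (\<Sum>i\<in>I. r i *\<^sub>R f (b i))"
  using assms(3,4)
proof (induction I rule: finite_induct)
  case empty
  have "f (0 *\<^sub>R 0 + 0 *\<^sub>R 0) = 0 *\<^sub>R f 0 + 0 *\<^sub>R f 0"
    using f subspace_0[OF S] unfolding lin_on_def by blast
  then show ?case by simp
next
  case (insert i I)
  have "(\<Sum>i\<in>I. r i *\<^sub>R b i) \<in> S"
    using insert.prems by (intro subspace_sum[OF S] subspace_mul[OF S]) auto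
  then have "f (r i *\<^sub>R b i + 1 *\<^sub>R (\<Sum>i\<in>I. r i *\<^sub>R b i))
      = r i *\<^sub>R f (b i) + 1 *\<^sub>R f (\<Sum>i\<in>I. r i *\<^sub>R b i)"
    using f insert.prems unfolding lin_on_def by blast
  then show ?case using insert by simp
qed

definition frame :: "'a::real_vector set \<Rightarrow> 'i set \<Rightarrow> ('i \<Rightarrow> 'a) \<Rightarrow> ('i \<Rightarrow> 'a \<Rightarrow> real) \<Rightarrow> bool" where
  "frame S I b \<phi> \<longleftrightarrow> finite I \<and> subspace S \<and> (\<forall>i\<in>I. b i \<in> S \<and> lin_on S (\<phi> i))
     \<and> (\<forall>x\<in>S. (\<Sum>i\<in>I. \<phi> i x *\<^sub>R b i) = x)"

lemma frame_representation:
  assumes "independent B" "finite B"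
  shows "frame (span B) B id (\<lambda>b x. representation B x b)"
  unfolding frame_def lin_on_def
  using assms
  by (auto simp: span_base representation_add representation_scale span_scale sum_representation_eq)

lemma chosen_basis:
  assumes "subspace S"
  defines "B \<equiv> (SOME B. independent B \<and> span B = S)"
  shows "independent B" "span B = S"
proof -
  obtain B0 where "independent B0" "B0 \<subseteq> S" "S \<subseteq> span B0"
    using basis_exists[of S] by metis
  then have "\<exists>B. independent B \<and> span B = S"
    using span_minimal[OF _ assms(1)] by (metis subset_antisym)
  then show "independent B" "span B = S"
    unfolding B_def by (metis (mono_tags, lifting) someI_ex)+
qed

text \<open>The trace can be computed from any resolution of the identity \<open>x = \<Sum> \<phi>\<^sub>i(x) b\<^sub>i\<close>,
  which need not come from a basis.\<close>

lemma trace_on_frame: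
  assumes fr: "frame S I b \<phi>" and F: "lin_on S F" and FS: "\<And>x. x \<in> S \<Longrightarrow> F x \<in> S"
  shows "trace_on S F = (\<Sum>i\<in>I. \<phi> i (F (b i)))"
proof -
  define B where "B = (SOME B. independent B \<and> span B = S)"
  have I: "finite I" and S: "subspace S" and b: "\<And>i. i \<in> I \<Longrightarrow> b i \<in> S"
    and \<phi>: "\<And>i. i \<in> I \<Longrightarrow> lin_on S (\<phi> i)" and id: "\<And>x. x \<in> S \<Longrightarrow> (\<Sum>i\<in>I. \<phi> i x *\<^sub>R b i) = x"
    using fr by (auto simp: frame_def)
  have B: "independent B" "span B = S"
    unfolding B_def using chosen_basis[OF S] by simp_all
  have "S \<subseteq> span (b ` I)"
  proof
    fix x assume "x \<in> S"
    then have "x = (\<Sum>i\<in>I. \<phi> i x *\<^sub>R b i)" using id by simp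
    then show "x \<in> span (b ` I)"
      by (metis (no_types, lifting) imageI span_base span_scale span_sum)
  qed
  \<comment> \<open>An independent set inside the span of finitely many vectors is finite; the
    choice behind \<open>trace_on\<close> does not provide this.\<close>
  then have "finite B"
    using independent_span_bound[of "b ` I" B] I B span_superset by blast
  then have frB: "frame S B id (\<lambda>b x. representation B x b)"
    using frame_representation B by blast
  have BS: "\<beta> \<in> S" if "\<beta> \<in> B" for \<beta> using B that span_base by blast
  have "(\<Sum>i\<in>I. \<phi> i (F (b i)))
      = (\<Sum>i\<in>I. \<phi> i (\<Sum>\<beta>\<in>B. representation B (F (b i)) \<beta> *\<^sub>R \<beta>))"
    using frB b FS by (simp add: frame_def cong: sum.cong)
  also have "\<dots> = (\<Sum>i\<in>I. \<Sum>\<beta>\<in>B. representation B (F (b i)) \<beta> * \<phi> i \<beta>)"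
  proof (rule sum.cong[OF refl])
    fix i assume "i \<in> I"
    from lin_on_sum[OF S \<phi>[OF this] \<open>finite B\<close>, of "\<lambda>\<beta>. \<beta>"] BS
    show "\<phi> i (\<Sum>\<beta>\<in>B. representation B (F (b i)) \<beta> *\<^sub>R \<beta>)
        = (\<Sum>\<beta>\<in>B. representation B (F (b i)) \<beta> * \<phi> i \<beta>)"
      by simp
  qed
  \<comment> \<open>After the exchange the inner sum runs over the frame, so it reassembles
    \<open>\<beta>\<close> instead of expanding \<open>F (b i)\<close>.\<close>
  also have "\<dots> = (\<Sum>\<beta>\<in>B. \<Sum>i\<in>I. \<phi> i \<beta> * representation B (F (b i)) \<beta>)"
    by (subst sum.swap) (simp add: mult.commute)
  also have "\<dots> = (\<Sum>\<beta>\<in>B. representation B (\<Sum>i\<in>I. \<phi> i \<beta> *\<^sub>R F (b i)) \<beta>)"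
  proof (rule sum.cong[OF refl])
    fix \<beta> assume "\<beta> \<in> B"
    then have "lin_on S (\<lambda>x. representation B x \<beta>)" using frB by (simp add: frame_def)
    from lin_on_sum[OF S this I, of "\<lambda>i. F (b i)" "\<lambda>i. \<phi> i \<beta>"]
    show "(\<Sum>i\<in>I. \<phi> i \<beta> * representation B (F (b i)) \<beta>)
        = representation B (\<Sum>i\<in>I. \<phi> i \<beta> *\<^sub>R F (b i)) \<beta>"
      using b FS by simp
  qed
  also have "\<dots> = (\<Sum>\<beta>\<in>B. representation B (F \<beta>) \<beta>)"
  proof (rule sum.cong[OF refl])
    fix \<beta> assume "\<beta> \<in> B"
    then have "F \<beta> = F (\<Sum>i\<in>I. \<phi> i \<beta> *\<^sub>R b i)" using id BS by simp
    also have "\<dots> = (\<Sum>i\<in>I. \<phi> i \<beta> *\<^sub>R F (b i))" by (rule lin_on_sum[OF S F I b])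
    finally show "representation B (\<Sum>i\<in>I. \<phi> i \<beta> *\<^sub>R F (b i)) \<beta> = representation B (F \<beta>) \<beta>"
      by simp
  qed
  finally show ?thesis unfolding trace_on_def Let_def B_def[symmetric] by simp
qed

text \<open>The inner product only reads off coordinates in \<open>Basis\<close>; by
  \<open>tr_frame\<close> the value does not depend on it.\<close>

definition tr :: "('t::euclidean_space \<Rightarrow> 't) \<Rightarrow> real" where
  "tr f = (\<Sum>b\<in>Basis. f b \<bullet> b)"

lemma frame_Basis: "frame UNIV Basis id (\<lambda>b x. x \<bullet> b)"
  by (simp add: frame_def lin_on_def inner_add_left euclidean_representation)

lemma tr_frame:
  assumes "frame UNIV I b \<phi>" "linear f"
  shows "tr f = (\<Sum>i\<in>I. \<phi> i (f (b i)))"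
  using trace_on_frame[OF assms(1) lin_on_linear[OF assms(2)]]
    trace_on_frame[OF frame_Basis lin_on_linear[OF assms(2)]]
  by (simp add: tr_def)

lemma tr_simps:
  "tr (\<lambda>z. f z + g z) = tr f + tr g"
  "tr (\<lambda>z. f z - g z) = tr f - tr g"
  "tr (\<lambda>z. - f z) = - tr f"
  "tr (\<lambda>z. r *\<^sub>R f z) = r * tr f"
  "tr (\<lambda>z. 0) = 0"
  "tr (\<lambda>z. z :: 't::euclidean_space) = DIM('t)"
  by (simp_all add: tr_def inner_add_left inner_diff_left sum.distrib sum_subtractf sum_negf
      sum_distrib_left)

lemma tr_rank_one:
  assumes "linear \<phi>"
  shows "tr (\<lambda>z. \<phi> z *\<^sub>R x) = \<phi> x"
proof -
  have "\<phi> x = \<phi> (\<Sum>b\<in>Basis. (x \<bullet> b) *\<^sub>R b)" by (simp add: euclidean_representation)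
  also have "\<dots> = (\<Sum>b\<in>Basis. (x \<bullet> b) * \<phi> b)"
    using assms by (simp add: linear_sum linear_scale)
  finally show ?thesis by (simp add: tr_def mult.commute)
qed

lemma frame_of_finite_span:
  assumes "subspace S" "S \<subseteq> span C" "finite C"
  obtains B where "frame S B (\<lambda>b. b) (\<lambda>b x. representation B x b)"
proof -
  obtain B where B: "independent B" "B \<subseteq> S" "S \<subseteq> span B"
    using basis_exists[of S] by metis
  then have S: "span B = S" using span_minimal[OF _ assms(1)] by (metis subset_antisym)
  have "finite B"
    using independent_span_bound[OF assms(3) B(1)] B(2) assms(2) by blast
  with frame_representation[OF B(1)] S that show ?thesis by (simp add: id_def)
qed

text \<open>Lets a map that is only known on \<open>S\<close>, such as the curvature on
  \<open>m_space\<close>, be replaced by a globally linear one.\<close>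

lemma trace_on_cong:
  assumes "subspace S" "\<And>x. x \<in> S \<Longrightarrow> F x = G x"
  shows "trace_on S F = trace_on S G"
proof -
  define B where "B = (SOME B. independent B \<and> span B = S)"
  have B: "independent B" "span B = S"
    unfolding B_def using chosen_basis[OF assms(1)] by simp_all
  have "b \<in> B \<Longrightarrow> F b = G b" for b
    using assms(2) B(2) span_base by blast
  then show ?thesis
    unfolding trace_on_def Let_def B_def[symmetric] by (simp cong: sum.cong)
qed

lemma trace_on_zero: "trace_on S (\<lambda>x. 0) = 0"
  by (simp add: trace_on_def Let_def representation_zero)

lemma trace_on_UNIV:
  assumes "linear f"
  shows "trace_on UNIV f = tr f"
  using trace_on_frame[OF frame_Basis lin_on_linear[OF assms]] by (simp add: tr_def)

lemma frame_Times:
  assumes S: "frame S I b \<phi>" and S': "frame S' J c \<psi>"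
  shows "frame (S \<times> S') (I <+> J) (case_sum (\<lambda>i. (b i, 0)) (\<lambda>j. (0, c j)))
     (case_sum (\<lambda>i x. \<phi> i (fst x)) (\<lambda>j x. \<psi> j (snd x)))"
proof -
  have "0 \<in> S" "0 \<in> S'" using S S' by (auto simp: frame_def subspace_0)
  then show ?thesis
    using S S'
    by (auto simp: frame_def lin_on_def sum.Plus subspace_Times prod_eq_iff fst_sum snd_sum)
qed

text \<open>The coordinates belonging to one factor ignore the other factor, so only the two
  diagonal blocks of \<open>F\<close> contribute.\<close>

lemma trace_on_Times:
  fixes S :: "'a::real_vector set" and S' :: "'c::real_vector set"
  assumes S: "frame S I b \<phi>" and S': "frame S' J c \<psi>"
    and F: "linear F" and FS: "\<And>x. x \<in> S \<times> S' \<Longrightarrow> F x \<in> S \<times> S'"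
  shows "trace_on (S \<times> S') F
    = trace_on S (\<lambda>x. fst (F (x, 0))) + trace_on S' (\<lambda>y. snd (F (0, y)))"
proof -
  have 0: "0 \<in> S" "0 \<in> S'" using S S' by (auto simp: frame_def subspace_0)
  note frS = frame_Times[OF S S']
  have l1: "lin_on S (\<lambda>x. fst (F (x, 0)))"
    unfolding lin_on_def
  proof (intro ballI allI)
    fix x y :: 'a and r s
    have "(r *\<^sub>R x + s *\<^sub>R y, 0) = r *\<^sub>R (x, 0) + s *\<^sub>R (y, 0 :: 'c)" by simp
    then show "fst (F (r *\<^sub>R x + s *\<^sub>R y, 0)) = r *\<^sub>R fst (F (x, 0)) + s *\<^sub>R fst (F (y, 0))"
      using F by (simp only: linear_add linear_scale fst_add fst_scaleR)
  qed
  have l2: "lin_on S' (\<lambda>x. snd (F (0, x)))"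
    unfolding lin_on_def
  proof (intro ballI allI)
    fix x y :: 'c and r s
    have "(0, r *\<^sub>R x + s *\<^sub>R y) = r *\<^sub>R (0 :: 'a, x) + s *\<^sub>R (0, y)" by simp
    then show "snd (F (0, r *\<^sub>R x + s *\<^sub>R y)) = r *\<^sub>R snd (F (0, x)) + s *\<^sub>R snd (F (0, y))"
      using F by (simp only: linear_add linear_scale snd_add snd_scaleR)
  qed
  have c1: "fst (F (x, 0)) \<in> S" if "x \<in> S" for x using FS[of "(x, 0)"] 0 that by (auto simp: mem_Times_iff)
  have c2: "snd (F (0, x)) \<in> S'" if "x \<in> S'" for x using FS[of "(0, x)"] 0 that by (auto simp: mem_Times_iff)
  have "finite I" "finite J" using S S' by (auto simp: frame_def)
  then show ?thesis
    using trace_on_frame[OF frS lin_on_linear[OF F] FS] trace_on_frame[OF S l1 c1]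
      trace_on_frame[OF S' l2 c2]
    by (simp add: sum.Plus)
qed

text \<open>Both sides are the double sum of \<open>\<phi> i (A e) * (C (b i) \<bullet> e)\<close>.
  The right-hand side no longer refers to \<open>S\<close>, so no explicit basis of \<open>S\<close>
  is required.\<close>

lemma trace_on_cyclic:
  fixes A :: "'t::euclidean_space \<Rightarrow> 'a::real_vector"
  assumes S: "frame S I b \<phi>" and A: "linear A" and C: "linear C" and AS: "\<And>x. A x \<in> S"
  shows "trace_on S (\<lambda>x. A (C x)) = tr (\<lambda>z. C (A z))"
proof -
  have I: "finite I" and sub: "subspace S" and \<phi>: "\<And>i. i \<in> I \<Longrightarrow> lin_on S (\<phi> i)"
    and id: "\<And>x. x \<in> S \<Longrightarrow> (\<Sum>i\<in>I. \<phi> i x *\<^sub>R b i) = x"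
    using S by (auto simp: frame_def)
  have "trace_on S (\<lambda>x. A (C x)) = (\<Sum>i\<in>I. \<phi> i (A (C (b i))))"
    using trace_on_frame[OF S, of "\<lambda>x. A (C x)"] AS linear_compose[OF C A]
    by (simp add: lin_on_linear o_def)
  also have "\<dots> = (\<Sum>i\<in>I. \<Sum>e\<in>Basis. (C (b i) \<bullet> e) * \<phi> i (A e))"
  proof (rule sum.cong[OF refl])
    fix i assume "i \<in> I"
    have "A (C (b i)) = A (\<Sum>e\<in>Basis. (C (b i) \<bullet> e) *\<^sub>R e)" by (simp add: euclidean_representation)
    also have "\<dots> = (\<Sum>e\<in>Basis. (C (b i) \<bullet> e) *\<^sub>R A e)"
      by (simp add: linear_sum[OF A] linear_scale[OF A])
    finally show "\<phi> i (A (C (b i))) = (\<Sum>e\<in>Basis. (C (b i) \<bullet> e) * \<phi> i (A e))"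
      using lin_on_sum[OF sub \<phi>[OF \<open>i \<in> I\<close>] finite_Basis, of A] AS by simp
  qed
  also have "\<dots> = (\<Sum>e\<in>Basis. \<Sum>i\<in>I. \<phi> i (A e) * (C (b i) \<bullet> e))"
    by (subst sum.swap) (simp add: mult.commute)
  also have "\<dots> = (\<Sum>e\<in>Basis. C (A e) \<bullet> e)"
  proof (rule sum.cong[OF refl])
    fix e :: 't
    have "C (A e) = C (\<Sum>i\<in>I. \<phi> i (A e) *\<^sub>R b i)" using id AS by simp
    also have "\<dots> = (\<Sum>i\<in>I. \<phi> i (A e) *\<^sub>R C (b i))" by (simp add: linear_sum[OF C] linear_scale[OF C])
    finally show "(\<Sum>i\<in>I. \<phi> i (A e) * (C (b i) \<bullet> e)) = C (A e) \<bullet> e"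
      by (simp add: inner_sum_left)
  qed
  finally show ?thesis by (simp add: tr_def)
qed

lemma tr_vec2:
  fixes f :: "'t::euclidean_space^2 \<Rightarrow> 't^2"
  assumes "linear f"
  shows "tr f = tr (\<lambda>z. f (axis 1 z) $ 1) + tr (\<lambda>z. f (axis 2 z) $ 2)"
proof -
  have *: "(\<Sum>b\<in>Basis. (x \<bullet> b) *\<^sub>R axis i b) = (axis i x :: 't^2)" for x :: 't and i
    by (auto simp: vec_eq_iff axis_def euclidean_representation)
  have "(\<Sum>i\<in>UNIV. \<Sum>b\<in>Basis. (w $ i \<bullet> b) *\<^sub>R axis i b) = w" for w :: "'t^2"
    by (simp add: * sum_2 vec_eq_iff forall_2 axis_def euclidean_representation)
  then have "frame UNIV (UNIV \<times> Basis) (\<lambda>(i, b). axis i b) (\<lambda>(i, b) w. (w :: 't^2) $ i \<bullet> b)"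
    by (auto simp: frame_def lin_on_def inner_add_left sum.cartesian_product')
  from tr_frame[OF this assms] show ?thesis
    by (simp add: tr_def sum.cartesian_product' sum_2)
qed

section \<open>Triple systems and the Killing form\<close>

context symplectic_triple_system
begin

lemma om_lin1: "linear (\<lambda>x. om x y)" and om_lin2: "linear (om x)"
  using om_bilinear by (auto simp: bilinear_def)

lemmas om_simps =
  linear_add[OF om_lin1] linear_add[OF om_lin2] linear_diff[OF om_lin1] linear_diff[OF om_lin2]
  linear_scale[OF om_lin1] linear_scale[OF om_lin2] linear_neg[OF om_lin1] linear_neg[OF om_lin2]
  linear_0[OF om_lin1] linear_0[OF om_lin2]

lemmas tp_simps =
  linear_add[OF tp_linear1] linear_add[OF tp_linear2] linear_add[OF tp_linear3]
  linear_diff[OF tp_linear1] linear_diff[OF tp_linear2] linear_diff[OF tp_linear3]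
  linear_scale[OF tp_linear1] linear_scale[OF tp_linear2] linear_scale[OF tp_linear3]
  linear_neg[OF tp_linear1] linear_neg[OF tp_linear2] linear_neg[OF tp_linear3]
  linear_0[OF tp_linear1] linear_0[OF tp_linear2] linear_0[OF tp_linear3]

lemma om_skew: "om y x = - om x y"
proof -
  have "om (x + y) (x + y) = om x x + om y x + (om x y + om y y)" by (simp only: om_simps)
  then show ?thesis by (simp add: om_alternating)
qed

text \<open>The radical of the form is an ideal.\<close>

lemma om_nondegenerate_of_simple:
  assumes simple: "\<And>I. sts_ideal tp I \<Longrightarrow> I = {0} \<or> I = UNIV" and x: "\<And>y. om x y = 0"
  shows "x = 0"
proof -
  define R where "R = {x. \<forall>y. om x y = 0}"
  have sub: "subspace R"
    by (auto simp: R_def subspace_def om_simps)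
  have inv: "tp u v z \<in> R" if "z \<in> R" for u v z
    using that by (simp add: R_def om_invariant)
  have "tp u z v \<in> R" if z: "z \<in> R" for u v z
  proof -
    have "om u z = 0" "om z v = 0"
      using z om_skew[of u z] by (simp_all add: R_def)
    then have "tp u z v = tp u v z + om u v *\<^sub>R z"
      using tp_swap[of u z v] by (simp add: algebra_simps)
    then show ?thesis
      using inv[OF z] z sub by (simp add: subspace_add subspace_mul)
  qed
  then have "sts_ideal tp R"
    using sub inv by (simp add: sts_ideal_def)
  moreover have "R \<noteq> UNIV"
    using om_nonzero by (auto simp: R_def)
  ultimately have "R = {0}" using simple by blast
  then show ?thesis using x by (auto simp: R_def)
qed

end

section \<open>Duality given by the nondegenerate form, and traces of the triple product\<close>

locale nondegenerate_sts = symplectic_triple_system +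
  assumes om_nondegenerate: "(\<And>y. om x y = 0) \<Longrightarrow> x = 0"
begin

text \<open>The Gram map \<open>J\<close> of the form is injective by nondegeneracy, hence
  surjective in finite dimension.\<close>

lemma om_dual_exists: "\<exists>x. \<forall>y. om x y = y \<bullet> b"
proof -
  define J where "J x = (\<Sum>b\<in>Basis. om x b *\<^sub>R b)" for x
  have J: "J x \<bullet> y = om x y" for x y
  proof -
    have "om x y = om x (\<Sum>b\<in>Basis. (y \<bullet> b) *\<^sub>R b)" by (simp add: euclidean_representation)
    also have "\<dots> = (\<Sum>b\<in>Basis. (y \<bullet> b) * om x b)"
      by (simp add: linear_sum[OF om_lin2] linear_scale[OF om_lin2])
    finally show ?thesis
      by (simp add: J_def inner_sum_left inner_commute[of y] mult.commute)
  qed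
  have "linear J"
    by (rule linearI) (auto simp: J_def om_simps scaleR_add_left sum.distrib scaleR_sum_right)
  moreover have "inj J"
    unfolding linear_injective_0[OF \<open>linear J\<close>]
    using J om_nondegenerate by (metis inner_zero_left)
  ultimately have "surj J" by (simp add: linear_injective_imp_surjective)
  then obtain x where "J x = b" by (metis surjD)
  then have "\<forall>y. om x y = y \<bullet> b" using J[of x] by (simp add: inner_commute)
  then show ?thesis by blast
qed

definition dual :: "'a \<Rightarrow> 'a" where
  "dual b = (SOME x. \<forall>y. om x y = y \<bullet> b)"

lemma dual: "om (dual b) y = y \<bullet> b"
  using someI_ex[OF om_dual_exists[of b]] unfolding dual_def by blast

text \<open>Both sides of the expansion have the same \<open>om\<close>-product with every
  \<open>y\<close>. The coordinates are themselves values of \<open>om\<close>, so invariance under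
  \<open>om\<close> can be applied inside a trace.\<close>

lemma frame_dual: "frame UNIV Basis dual (\<lambda>b x. om x b)"
proof -
  have "(\<Sum>b\<in>Basis. om x b *\<^sub>R dual b) = x" for x
  proof -
    have "om ((\<Sum>b\<in>Basis. om x b *\<^sub>R dual b) - x) y = 0" for y
    proof -
      have "om x y = om x (\<Sum>b\<in>Basis. (y \<bullet> b) *\<^sub>R b)" by (simp add: euclidean_representation)
      also have "\<dots> = (\<Sum>b\<in>Basis. (y \<bullet> b) * om x b)"
        by (simp add: linear_sum[OF om_lin2] linear_scale[OF om_lin2])
      finally show ?thesis
        by (simp add: om_simps linear_sum[OF om_lin1] dual mult.commute)
    qed
    from om_nondegenerate[OF this] show ?thesis by simp
  qed
  then show ?thesis
    by (simp add: frame_def lin_on_linear[OF om_lin1])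
qed

text \<open>Moving \<open>d\<close> across \<open>om\<close> turns the trace in the frame
  \<open>dual\<close> into minus the trace in \<open>Basis\<close>; a number equal to its own
  negative is zero.\<close>

lemma tr_skew:
  assumes d: "linear d" and skew: "\<And>u v. om (d u) v = - om u (d v)"
  shows "tr d = 0"
proof -
  have "tr d = (\<Sum>b\<in>Basis. om (d (dual b)) b)"
    using tr_frame[OF frame_dual d] .
  also have "\<dots> = - (\<Sum>b\<in>Basis. d b \<bullet> b)"
    by (simp add: skew dual sum_negf)
  finally show ?thesis by (simp add: tr_def)
qed

lemma tr_tp: "tr (\<lambda>z. tp x y z) = 0"
  by (rule tr_skew[OF tp_linear3 om_invariant])

text \<open>The derivation \<open>tp y x\<close> is trace-free, so \<open>tp_swap\<close> leaves only multiples of the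
  form.\<close>

lemma tr_tp2: "tr (\<lambda>z. tp y z x) = (real DIM('a) + 1) * om y x"
proof -
  have "(\<lambda>z. tp y z x) = (\<lambda>z. tp y x z + om y x *\<^sub>R z - om y z *\<^sub>R x + 2 *\<^sub>R (om z x *\<^sub>R y))"
  proof
    fix z show "tp y z x = tp y x z + om y x *\<^sub>R z - om y z *\<^sub>R x + 2 *\<^sub>R (om z x *\<^sub>R y)"
      using tp_swap[of y z x] by (simp add: algebra_simps)
  qed
  then have "tr (\<lambda>z. tp y z x) = real DIM('a) * om y x - om y x + 2 * om y x"
    by (simp add: tr_simps tr_tp tr_rank_one om_lin1 om_lin2 del: scaleR_scaleR)
  then show ?thesis by (simp add: algebra_simps)
qed

lemma tr_tp1: "tr (\<lambda>z. tp z y x) = (real DIM('a) + 1) * om y x"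
  using tr_tp2 by (simp add: tp_sym[of _ y])

end

section \<open>Matrix coordinates on sp(V)\<close>

definition entry :: "((real^2) \<Rightarrow>\<^sub>L (real^2)) \<Rightarrow> 2 \<Rightarrow> 2 \<Rightarrow> real" where
  "entry \<gamma> i j = blinfun_apply \<gamma> (axis j 1) $ i"

lemma apply_entry: "blinfun_apply \<gamma> v $ i = entry \<gamma> i 1 * v $ 1 + entry \<gamma> i 2 * v $ 2"
  by (subst vec2_expand[of v]) (simp add: blinfun.add_right blinfun.scaleR_right entry_def)

lemma entry_eqI: "(\<And>i j. entry \<gamma> i j = entry \<gamma>' i j) \<Longrightarrow> \<gamma> = \<gamma>'"
  by (rule blinfun_eqI) (simp add: vec_eq_iff apply_entry)

lemma entry_simps:
  "entry (\<gamma> + \<gamma>') i j = entry \<gamma> i j + entry \<gamma>' i j"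
  "entry (\<gamma> - \<gamma>') i j = entry \<gamma> i j - entry \<gamma>' i j"
  "entry (- \<gamma>) i j = - entry \<gamma> i j"
  "entry (r *\<^sub>R \<gamma>) i j = r * entry \<gamma> i j"
  "entry 0 i j = 0"
  "entry (\<gamma> o\<^sub>L \<gamma>') i j = entry \<gamma> i 1 * entry \<gamma>' 1 j + entry \<gamma> i 2 * entry \<gamma>' 2 j"
  "entry (gam a b) i j = symp2 a (axis j 1) * b $ i + symp2 b (axis j 1) * a $ i"
  by (simp_all add: entry_def blinfun.add_left blinfun.diff_left blinfun.minus_left blinfun.scaleR_left
      gam_apply apply_entry[of \<gamma> "blinfun_apply \<gamma>' (axis j 1)", unfolded entry_def])

text \<open>\<open>symp2\<close> is the determinant form of the plane, so sp(V) is sl_2: the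
  condition is vanishing trace.\<close>

lemma spV_iff: "\<gamma> \<in> spV \<longleftrightarrow> entry \<gamma> 2 2 = - entry \<gamma> 1 1"
proof
  assume "\<gamma> \<in> spV"
  then have "symp2 (blinfun_apply \<gamma> (axis 1 1)) (axis 2 1) + symp2 (axis 1 1) (blinfun_apply \<gamma> (axis 2 1)) = 0"
    by (auto simp: spV_def)
  then show "entry \<gamma> 2 2 = - entry \<gamma> 1 1" by (simp add: symp2_def entry_def axis_def)
next
  assume "entry \<gamma> 2 2 = - entry \<gamma> 1 1"
  then show "\<gamma> \<in> spV" by (simp add: spV_def symp2_def apply_entry algebra_simps)
qed

lemma subspace_spV: "subspace spV"
  by (auto simp: subspace_def spV_iff entry_simps)

definition comm :: "('a::real_normed_vector \<Rightarrow>\<^sub>L 'a) \<Rightarrow> ('a \<Rightarrow>\<^sub>L 'a) \<Rightarrow> ('a \<Rightarrow>\<^sub>L 'a)" where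
  "comm x y = (x o\<^sub>L y) - (y o\<^sub>L x)"

lemma comm_bilinear: "bilinear comm"
  unfolding bilinear_def
  by (auto intro!: linearI blinfun_eqI simp: comm_def blinfun.bilinear_simps algebra_simps)

lemmas comm_simps =
  bilinear_ladd[OF comm_bilinear] bilinear_radd[OF comm_bilinear]
  bilinear_lmul[OF comm_bilinear] bilinear_rmul[OF comm_bilinear]
  bilinear_lzero[OF comm_bilinear] bilinear_rzero[OF comm_bilinear]
  bilinear_lneg[OF comm_bilinear] bilinear_rneg[OF comm_bilinear]
  bilinear_lsub[OF comm_bilinear] bilinear_rsub[OF comm_bilinear]

lemma comm_spV: "\<gamma> \<in> spV \<Longrightarrow> \<gamma>' \<in> spV \<Longrightarrow> comm \<gamma> \<gamma>' \<in> spV"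
  by (simp add: spV_iff entry_simps comm_def algebra_simps)

text \<open>The standard basis H, E, F of sl_2, expressed through \<open>gam\<close>;
  \<open>sp_coord\<close> reads off the matching entries 1 1, 1 2 and 2 1.\<close>

definition sp_basis :: "nat \<Rightarrow> (real^2) \<Rightarrow>\<^sub>L (real^2)" where
  "sp_basis k = (if k = 0 then - gam (axis 1 1) (axis 2 1)
     else if k = 1 then (1/2) *\<^sub>R gam (axis 1 1) (axis 1 1)
     else - (1/2) *\<^sub>R gam (axis 2 1) (axis 2 1))"

definition sp_coord :: "nat \<Rightarrow> ((real^2) \<Rightarrow>\<^sub>L (real^2)) \<Rightarrow> real" where
  "sp_coord k \<gamma> = (if k = 0 then entry \<gamma> 1 1 else if k = 1 then entry \<gamma> 1 2 else entry \<gamma> 2 1)"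

lemma lessThan_3: "{..<3::nat} = {0, 1, 2}"
  by auto

lemma entry_sp_basis:
  "entry (sp_basis 0) 1 1 = 1" "entry (sp_basis 0) 1 2 = 0" "entry (sp_basis 0) 2 1 = 0" "entry (sp_basis 0) 2 2 = -1"
  "entry (sp_basis (Suc 0)) 1 1 = 0" "entry (sp_basis (Suc 0)) 1 2 = 1" "entry (sp_basis (Suc 0)) 2 1 = 0" "entry (sp_basis (Suc 0)) 2 2 = 0"
  "entry (sp_basis 2) 1 1 = 0" "entry (sp_basis 2) 1 2 = 0" "entry (sp_basis 2) 2 1 = 1" "entry (sp_basis 2) 2 2 = 0"
  by (simp_all add: sp_basis_def entry_simps symp2_def axis_def)

lemma frame_spV: "frame spV {..<3} sp_basis sp_coord"
  unfolding frame_def lin_on_def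
proof (intro conjI ballI allI)
  fix \<gamma> :: "(real^2) \<Rightarrow>\<^sub>L (real^2)" assume "\<gamma> \<in> spV"
  then have "entry (\<Sum>i<3. sp_coord i \<gamma> *\<^sub>R sp_basis i) i j = entry \<gamma> i j" for i j
    using exhaust_2[of i] exhaust_2[of j]
    by (auto simp: lessThan_3 entry_simps sp_coord_def entry_sp_basis spV_iff)
  then show "(\<Sum>i<3. sp_coord i \<gamma> *\<^sub>R sp_basis i) = \<gamma>" by (rule entry_eqI)
qed (auto simp: lessThan_3 subspace_spV spV_iff entry_sp_basis sp_coord_def entry_simps)

lemma trace_on_spV:
  assumes "linear F" "\<And>\<gamma>. \<gamma> \<in> spV \<Longrightarrow> F \<gamma> \<in> spV"
  shows "trace_on spV F = entry (F (sp_basis 0)) 1 1 + entry (F (sp_basis 1)) 1 2 + entry (F (sp_basis 2)) 2 1"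
  using trace_on_frame[OF frame_spV lin_on_linear[OF assms(1)] assms(2)]
  by (simp add: lessThan_3 sp_coord_def)

lemma act_sp_nth: "act_sp \<gamma> w $ i = entry \<gamma> i 1 *\<^sub>R w $ 1 + entry \<gamma> i 2 *\<^sub>R w $ 2"
  by (simp add: act_sp_def tens_def sum_2 entry_def)

lemma act_der_nth: "act_der d w $ i = blinfun_apply d (w $ i)"
  by (simp add: act_der_def)

lemma act_sp_bilinear: "bilinear act_sp"
  unfolding bilinear_def
  by (auto intro!: linearI simp: vec_eq_iff act_sp_nth entry_simps algebra_simps)

lemma act_der_bilinear: "bilinear act_der"
  unfolding bilinear_def
  by (auto intro!: linearI simp: vec_eq_iff act_der_nth blinfun.bilinear_simps algebra_simps)

lemmas act_sp_simps =
  bilinear_ladd[OF act_sp_bilinear] bilinear_radd[OF act_sp_bilinear]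
  bilinear_lmul[OF act_sp_bilinear] bilinear_rmul[OF act_sp_bilinear]
  bilinear_lzero[OF act_sp_bilinear] bilinear_rzero[OF act_sp_bilinear]
  bilinear_lneg[OF act_sp_bilinear] bilinear_rneg[OF act_sp_bilinear]
  bilinear_lsub[OF act_sp_bilinear] bilinear_rsub[OF act_sp_bilinear]

lemmas act_der_simps =
  bilinear_ladd[OF act_der_bilinear] bilinear_radd[OF act_der_bilinear]
  bilinear_lmul[OF act_der_bilinear] bilinear_rmul[OF act_der_bilinear]
  bilinear_lzero[OF act_der_bilinear] bilinear_rzero[OF act_der_bilinear]
  bilinear_lneg[OF act_der_bilinear] bilinear_rneg[OF act_der_bilinear]
  bilinear_lsub[OF act_der_bilinear] bilinear_rsub[OF act_der_bilinear]

section \<open>The bracket in components and its closure properties\<close>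

context symplectic_triple_system
begin

definition bracket_sp :: "'t^2 \<Rightarrow> 't^2 \<Rightarrow> (real^2) \<Rightarrow>\<^sub>L (real^2)" where
  "bracket_sp w w' = (\<Sum>i\<in>UNIV. \<Sum>j\<in>UNIV. om (w $ i) (w' $ j) *\<^sub>R gam (axis i 1) (axis j 1))"

text \<open>Of the four terms in the sum over pairs of basis vectors of V, only those with distinct
  indices survive, with signs 1 and -1.\<close>

definition bracket_inder :: "'t^2 \<Rightarrow> 't^2 \<Rightarrow> 't \<Rightarrow>\<^sub>L 't" where
  "bracket_inder w w' = inner_der tp (w $ 1) (w' $ 2) - inner_der tp (w $ 2) (w' $ 1)"

lemma bracket_eq:
  "bracket om tp (\<gamma>, d, w) (\<gamma>', d', w') =
     (comm \<gamma> \<gamma>' + bracket_sp w w', comm d d' + bracket_inder w w',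
      act_sp \<gamma> w' + act_der d w' - act_sp \<gamma>' w - act_der d' w)"
  by (simp add: comm_def bracket_sp_def bracket_inder_def sum_2 symp2_def axis_def)

lemma entry_bracket_sp:
  "entry (bracket_sp w w') 1 1 = - (om (w $ 1) (w' $ 2) + om (w $ 2) (w' $ 1))"
  "entry (bracket_sp w w') 1 2 = 2 * om (w $ 1) (w' $ 1)"
  "entry (bracket_sp w w') 2 1 = - 2 * om (w $ 2) (w' $ 2)"
  "entry (bracket_sp w w') 2 2 = om (w $ 1) (w' $ 2) + om (w $ 2) (w' $ 1)"
  by (simp_all add: bracket_sp_def sum_2 entry_simps symp2_def axis_def)

lemma bracket_sp_spV: "bracket_sp w w' \<in> spV"
  by (simp add: spV_iff entry_bracket_sp)

lemma bracket_sp_bilinear: "bilinear bracket_sp"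
  unfolding bilinear_def
  by (auto intro!: linearI simp: bracket_sp_def sum_2 om_simps algebra_simps)

lemma inner_der_bilinear: "bilinear (inner_der tp)"
  unfolding bilinear_def
  by (auto intro!: linearI blinfun_eqI simp: inner_der_apply tp_simps blinfun.bilinear_simps)

lemmas inner_der_simps =
  bilinear_ladd[OF inner_der_bilinear] bilinear_radd[OF inner_der_bilinear]
  bilinear_lmul[OF inner_der_bilinear] bilinear_rmul[OF inner_der_bilinear]
  bilinear_lzero[OF inner_der_bilinear] bilinear_rzero[OF inner_der_bilinear]
  bilinear_lneg[OF inner_der_bilinear] bilinear_rneg[OF inner_der_bilinear]
  bilinear_lsub[OF inner_der_bilinear] bilinear_rsub[OF inner_der_bilinear]

lemma bracket_inder_bilinear: "bilinear bracket_inder"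
  unfolding bilinear_def
  by (auto intro!: linearI simp: bracket_inder_def inner_der_simps algebra_simps)

lemmas bracket_inder_simps =
  bilinear_ladd[OF bracket_inder_bilinear] bilinear_radd[OF bracket_inder_bilinear]
  bilinear_lmul[OF bracket_inder_bilinear] bilinear_rmul[OF bracket_inder_bilinear]
  bilinear_lzero[OF bracket_inder_bilinear] bilinear_rzero[OF bracket_inder_bilinear]
  bilinear_lneg[OF bracket_inder_bilinear] bilinear_rneg[OF bracket_inder_bilinear]
  bilinear_lsub[OF bracket_inder_bilinear] bilinear_rsub[OF bracket_inder_bilinear]

lemmas bracket_sp_simps =
  bilinear_ladd[OF bracket_sp_bilinear] bilinear_radd[OF bracket_sp_bilinear]
  bilinear_lmul[OF bracket_sp_bilinear] bilinear_rmul[OF bracket_sp_bilinear]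
  bilinear_lzero[OF bracket_sp_bilinear] bilinear_rzero[OF bracket_sp_bilinear]
  bilinear_lneg[OF bracket_sp_bilinear] bilinear_rneg[OF bracket_sp_bilinear]
  bilinear_lsub[OF bracket_sp_bilinear] bilinear_rsub[OF bracket_sp_bilinear]

lemma bracket_inder_apply: "blinfun_apply (bracket_inder w w') z = tp (w $ 1) (w' $ 2) z - tp (w $ 2) (w' $ 1) z"
  by (simp add: bracket_inder_def blinfun.diff_left inner_der_apply)

lemma subspace_inder: "subspace (inder tp)"
  by (simp add: inder_def)

lemma inner_der_inder: "inner_der tp x y \<in> inder tp"
  unfolding inder_def by (rule span_base) blast

lemma bracket_inder_inder: "bracket_inder w w' \<in> inder tp"
  unfolding bracket_inder_def by (intro subspace_diff[OF subspace_inder] inner_der_inder)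

lemma bracket_linear: "linear (bracket om tp X)"
proof (cases X)
  case (fields \<gamma> d w)
  show ?thesis
    unfolding fields
    by (rule linearI)
      (auto simp: bracket_eq comm_simps bracket_sp_simps bracket_inder_simps act_sp_simps act_der_simps algebra_simps
        simp del: bracket.simps)
qed

lemma bracket_linear1: "linear (\<lambda>X. bracket om tp X Y)"
proof (cases Y)
  case (fields \<gamma> d w)
  show ?thesis
    unfolding fields
    by (rule linearI)
      (auto simp: bracket_eq comm_simps bracket_sp_simps bracket_inder_simps act_sp_simps act_der_simps algebra_simps
        simp del: bracket.simps)
qed

lemma inder_skew:
  assumes "d \<in> inder tp"
  shows "om (blinfun_apply d x) y = - om x (blinfun_apply d y)"
  using assms unfolding inder_def
  by (induction rule: span_induct_alt)
    (auto simp: blinfun.bilinear_simps om_simps inner_der_apply om_invariant algebra_simps)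

text \<open>Axiom (3), read as an identity between operators acting on the last argument
  \<open>w\<close>.\<close>

lemma comm_inner_der:
  "comm (inner_der tp x y) (inner_der tp u v) = inner_der tp (tp x y u) v + inner_der tp u (tp x y v)"
proof (rule blinfun_eqI)
  fix z
  show "blinfun_apply (comm (inner_der tp x y) (inner_der tp u v)) z
      = blinfun_apply (inner_der tp (tp x y u) v + inner_der tp u (tp x y v)) z"
    using tp_derivation[of x y u v z]
    by (simp add: comm_def blinfun.bilinear_simps inner_der_apply)
qed

lemma comm_inder:
  assumes d: "d \<in> inder tp" and d': "d' \<in> inder tp"
  shows "comm d d' \<in> inder tp"
proof -
  note sub = subspace_0[OF subspace_inder] subspace_add[OF subspace_inder]
    subspace_mul[OF subspace_inder] inner_der_inder
  have 1: "comm (inner_der tp x y) d' \<in> inder tp" for x y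
    using d'[unfolded inder_def]
    by (induction rule: span_induct_alt) (auto simp: comm_simps comm_inner_der intro!: sub)
  show ?thesis
    using d[unfolded inder_def]
    by (induction rule: span_induct_alt) (auto simp: comm_simps intro!: sub 1)
qed

lemma envel_space_eq: "envel_space tp = spV \<times> inder tp \<times> UNIV"
  by (auto simp: envel_space_def)

lemma m_space_eq: "(m_space :: 't envel set) = spV \<times> {0} \<times> UNIV"
  by (auto simp: m_space_def)

lemma bracket_envel: "X \<in> envel_space tp \<Longrightarrow> Y \<in> envel_space tp \<Longrightarrow> bracket om tp X Y \<in> envel_space tp"
  by (auto simp: envel_space_eq bracket_eq simp del: bracket.simps
    intro!: subspace_add[OF subspace_spV] subspace_add[OF subspace_inder] comm_spV comm_inder bracket_sp_spV bracket_inder_inder)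

text \<open>The generating set of \<open>inder tp\<close> is infinite, but by bilinearity the
  operators \<open>inner_der tp b b'\<close> with \<open>b\<close>, \<open>b'\<close> in
  \<open>Basis\<close> already span it.\<close>

lemma frame_inder:
  obtains B where "frame (inder tp) B (\<lambda>b. b) (\<lambda>b x. representation B x b)"
proof (rule frame_of_finite_span[OF subspace_inder])
  let ?C = "(\<lambda>(b, b'). inner_der tp b b') ` (Basis \<times> Basis)"
  show "finite ?C" by simp
  have "inner_der tp x y \<in> span ?C" for x y
  proof -
    have "inner_der tp x y = inner_der tp (\<Sum>b\<in>Basis. (x \<bullet> b) *\<^sub>R b) (\<Sum>b\<in>Basis. (y \<bullet> b) *\<^sub>R b)"
      by (simp add: euclidean_representation)
    also have "\<dots> \<in> span ?C"
      by (simp add: bilinear_sum[OF inner_der_bilinear] inner_der_simps split_def)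
        (intro span_sum span_scale[OF span_base], auto)
    finally show ?thesis .
  qed
  then show "inder tp \<subseteq> span ?C"
    unfolding inder_def by (intro span_minimal) auto
qed (rule that)

end

text \<open>On \<open>spV\<close> this is tr(\<gamma>\<gamma>'): for trace-free matrices the 2 2
  entries contribute the same product as the 1 1 entries, hence the factor 2.\<close>

definition trace_sp :: "((real^2) \<Rightarrow>\<^sub>L (real^2)) \<Rightarrow> ((real^2) \<Rightarrow>\<^sub>L (real^2)) \<Rightarrow> real" where
  "trace_sp \<gamma> \<gamma>' = 2 * (entry \<gamma> 1 1 * entry \<gamma>' 1 1) + entry \<gamma> 1 2 * entry \<gamma>' 2 1 + entry \<gamma> 2 1 * entry \<gamma>' 1 2"

section \<open>Block traces and the Killing form\<close>

context symplectic_triple_system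
begin

lemma tr_om:
  "tr (\<lambda>z. om y z *\<^sub>R x) = om y x"
  "tr (\<lambda>z. om z y *\<^sub>R x) = om x y"
  "tr (\<lambda>z. (r * om y z) *\<^sub>R x) = r * om y x"
  "tr (\<lambda>z. (r * om z y) *\<^sub>R x) = r * om x y"
  "tr (\<lambda>z. (om y z / r) *\<^sub>R x) = om y x / r"
  "tr (\<lambda>z. (om z y / r) *\<^sub>R x) = om x y / r"
  using tr_simps(4)[of "1 / r" "\<lambda>z. om y z *\<^sub>R x"] tr_simps(4)[of "1 / r" "\<lambda>z. om z y *\<^sub>R x"]
    tr_simps(4)[of r "\<lambda>z. om y z *\<^sub>R x"] tr_simps(4)[of r "\<lambda>z. om z y *\<^sub>R x"]
  by (simp_all add: tr_rank_one om_lin1 om_lin2)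

text \<open>The tensor product of \<open>symp2\<close> and \<open>om\<close> on V \<otimes> T; as a
  product of two alternating forms it is symmetric.\<close>

definition om_V :: "'t^2 \<Rightarrow> 't^2 \<Rightarrow> real" where
  "om_V w w' = om (w $ 1) (w' $ 2) - om (w $ 2) (w' $ 1)"

text \<open>The middle factor \<open>D\<close> is left open to cover two cases:
  \<open>inder tp\<close> for the Killing form and \<open>{0}\<close> for traces over
  \<open>m_space\<close>.\<close>

lemma trace_on_triple:
  fixes F :: "'t envel \<Rightarrow> 't envel"
  assumes D: "frame D B b \<phi>" and F: "linear F" and FS: "\<And>x. x \<in> spV \<times> D \<times> UNIV \<Longrightarrow> F x \<in> spV \<times> D \<times> UNIV"
  shows "trace_on (spV \<times> D \<times> UNIV) F
    = trace_on spV (\<lambda>\<gamma>. fst (F (\<gamma>, 0, 0))) + trace_on D (\<lambda>d. fst (snd (F (0, d, 0))))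
      + tr (\<lambda>w. snd (snd (F (0, 0, w))))"
proof -
  have D0: "subspace D" "0 \<in> D" using D by (auto simp: frame_def subspace_0)
  let ?F2 = "\<lambda>y. snd (F (0, y))"
  have P: "linear (\<lambda>y. (0 :: 'u::real_vector, y :: 'v::real_vector))"
    by (rule linearI) auto
  have l2: "linear ?F2"
    using linear_compose[OF linear_compose[OF P F] linear_snd] by (simp add: o_def)
  have l3: "linear (\<lambda>w. snd (?F2 (0, w)))"
    using linear_compose[OF linear_compose[OF P l2] linear_snd] by (simp add: o_def)
  have FS2: "?F2 y \<in> D \<times> UNIV" if "y \<in> D \<times> UNIV" for y
    using FS[of "(0, y)"] that subspace_0[OF subspace_spV] by (auto simp: mem_Times_iff)
  have fr2: "frame (D \<times> (UNIV :: ('t^2) set)) (B <+> Basis) (case_sum (\<lambda>i. (b i, 0)) (\<lambda>j. (0, j)))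
     (case_sum (\<lambda>i x. \<phi> i (fst x)) (\<lambda>j x. snd x \<bullet> j))"
    using frame_Times[OF D frame_Basis] by simp
  show ?thesis
    using trace_on_Times[OF frame_spV fr2 F FS] trace_on_Times[OF D frame_Basis l2 FS2]
      trace_on_UNIV[OF l3]
    by (simp add: zero_prod_def)
qed

lemma trace_on_envel:
  assumes "linear F" "\<And>X. X \<in> envel_space tp \<Longrightarrow> F X \<in> envel_space tp"
  shows "trace_on (envel_space tp) F
    = trace_on spV (\<lambda>\<gamma>. fst (F (\<gamma>, 0, 0))) + trace_on (inder tp) (\<lambda>d. fst (snd (F (0, d, 0))))
      + tr (\<lambda>w. snd (snd (F (0, 0, w))))"
proof -
  obtain B where "frame (inder tp) B (\<lambda>b. b) (\<lambda>b x. representation B x b)" by (rule frame_inder)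
  from trace_on_triple[OF this assms(1)] assms(2) show ?thesis by (simp add: envel_space_eq)
qed

lemma trace_on_m:
  fixes F :: "'t envel \<Rightarrow> 't envel"
  assumes "linear F" "\<And>X. X \<in> m_space \<Longrightarrow> F X \<in> m_space"
  shows "trace_on m_space F
    = trace_on spV (\<lambda>\<gamma>. fst (F (\<gamma>, 0, 0))) + tr (\<lambda>w. snd (snd (F (0, 0, w))))"
proof -
  have fr: "frame {0 :: 't \<Rightarrow>\<^sub>L 't} ({} :: nat set) (\<lambda>i. 0) (\<lambda>i x. 0)" by (auto simp: frame_def subspace_def)
  have 0: "fst (snd (F (0, 0, 0))) = 0"
    using linear_0[OF assms(1)] by (simp add: zero_prod_def)
  then have "trace_on {0} (\<lambda>d. fst (snd (F (0, d, 0)))) = 0"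
    by (subst trace_on_frame[OF fr]) (auto simp: lin_on_def)
  then show ?thesis using trace_on_triple[OF fr assms(1)] assms(2) by (simp add: m_space_eq)
qed

lemma killing_linear: "linear (\<lambda>Z. bracket om tp X (bracket om tp Y Z))"
  using linear_compose[OF bracket_linear bracket_linear] by (simp add: o_def)

lemma killing_eq:
  assumes "X \<in> envel_space tp" "Y \<in> envel_space tp"
  shows "killing om tp X Y
    = trace_on spV (\<lambda>\<gamma>. fst (bracket om tp X (bracket om tp Y (\<gamma>, 0, 0))))
      + trace_on (inder tp) (\<lambda>d. fst (snd (bracket om tp X (bracket om tp Y (0, d, 0)))))
      + tr (\<lambda>w. snd (snd (bracket om tp X (bracket om tp Y (0, 0, w)))))"
  unfolding killing_def
  by (rule trace_on_envel) (simp_all add: killing_linear bracket_envel assms)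

text \<open>The adjoint representation of sl_2 contributes 4 tr(\<gamma>\<gamma>'). V \<otimes> T
  consists of \<open>DIM('t)\<close> copies of V, each contributing tr(\<gamma>\<gamma>'). The block
  of \<open>inder tp\<close> vanishes because it commutes with sp(V).\<close>

lemma killing_sp:
  assumes "\<gamma> \<in> spV" "\<gamma>' \<in> spV"
  shows "killing om tp (\<gamma>, 0, 0) (\<gamma>', 0, 0) = (4 + DIM('t)) * trace_sp \<gamma> \<gamma>'"
proof -
  have "trace_on spV (\<lambda>\<zeta>. comm \<gamma> (comm \<gamma>' \<zeta>)) = 4 * trace_sp \<gamma> \<gamma>'"
  proof (subst trace_on_spV)
    show "linear (\<lambda>\<zeta>. comm \<gamma> (comm \<gamma>' \<zeta>))" by (rule linearI) (simp_all add: comm_simps)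
  qed (use assms in \<open>auto simp: comm_spV trace_sp_def comm_def entry_simps entry_sp_basis spV_iff algebra_simps\<close>)
  moreover have "tr (\<lambda>w :: 't^2. act_sp \<gamma> (act_sp \<gamma>' w)) = DIM('t) * trace_sp \<gamma> \<gamma>'"
  proof (subst tr_vec2)
    show "linear (\<lambda>w :: 't^2. act_sp \<gamma> (act_sp \<gamma>' w))" by (rule linearI) (simp_all add: act_sp_simps)
  qed (use assms in \<open>auto simp: trace_sp_def act_sp_nth axis_def tr_simps spV_iff algebra_simps\<close>)
  ultimately show ?thesis
    using assms subspace_0[OF subspace_spV] subspace_0[OF subspace_inder]
    by (subst killing_eq) (simp_all add: envel_space_eq bracket_eq comm_simps bracket_sp_simps bracket_inder_simps
        act_sp_simps act_der_simps trace_on_zero algebra_simps del: bracket.simps)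
qed

end

context nondegenerate_sts
begin

text \<open>With d = \<open>DIM('a)\<close>, the blocks of sp(V), \<open>inder tp\<close> and V
  \<otimes> T contribute -3, -(d+1) and -(d+4) times \<open>om_V w w'\<close>. The last is the sum
  of the first two, as cyclicity predicts: it composes the same maps in the opposite order, with
  \<open>w\<close> and \<open>w'\<close> exchanged.\<close>

lemma killing_odd: "killing om tp (0, 0, w) (0, 0, w') = - 2 * (DIM('a) + 4) * om_V w w'"
proof -
  have sp: "trace_on spV (\<lambda>\<zeta>. - bracket_sp w (act_sp \<zeta> w')) = - 3 * om_V w w'"
  proof (subst trace_on_spV)
    show "linear (\<lambda>\<zeta>. - bracket_sp w (act_sp \<zeta> w'))" by (rule linearI) (simp_all add: bracket_sp_simps act_sp_simps)
  qed (simp_all add: subspace_neg[OF subspace_spV] bracket_sp_spV om_V_def entry_simps entry_bracket_sp act_sp_nth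
        entry_sp_basis om_simps)
  obtain B where fr: "frame (inder tp) B (\<lambda>b. b) (\<lambda>b x. representation B x b)" by (rule frame_inder)
  have "linear (\<lambda>z. - bracket_inder w z)" "linear (\<lambda>d. act_der d w')"
    by (auto intro!: linearI simp: bracket_inder_simps act_der_simps)
  \<comment> \<open>Here \<open>A\<close> sends \<open>z\<close> in \<open>T^2\<close> to
    \<open>- bracket_inder w z\<close> and \<open>C\<close> sends a derivation \<open>d\<close> to
    \<open>act_der d w'\<close>, so the trace becomes one over \<open>T^2\<close> that
    \<open>tr_tp2\<close> evaluates.\<close>
  from trace_on_cyclic[OF fr this]
  have "trace_on (inder tp) (\<lambda>d. - bracket_inder w (act_der d w')) = tr (\<lambda>z. act_der (- bracket_inder w z) w')"
    by (simp add: subspace_neg[OF subspace_inder] bracket_inder_inder)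
  also have "\<dots> = - (DIM('a) + 1) * om_V w w'"
  proof (subst tr_vec2)
    show "linear (\<lambda>z. act_der (- bracket_inder w z) w')"
      by (rule linearI) (simp_all add: bracket_inder_simps act_der_simps)
  qed (simp add: act_der_nth blinfun.minus_left bracket_inder_apply axis_def tp_simps tr_simps tr_tp2
      om_V_def algebra_simps)
  finally have h: "trace_on (inder tp) (\<lambda>d. - bracket_inder w (act_der d w')) = - (DIM('a) + 1) * om_V w w'" .
  have "tr (\<lambda>z. - act_sp (bracket_sp w' z) w - act_der (bracket_inder w' z) w) = - (DIM('a) + 4) * om_V w w'"
  proof (subst tr_vec2)
    show "linear (\<lambda>z. - act_sp (bracket_sp w' z) w - act_der (bracket_inder w' z) w)"
      by (rule linearI) (simp_all add: bracket_sp_simps bracket_inder_simps act_sp_simps act_der_simps algebra_simps)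
  next
    show "tr (\<lambda>z. (- act_sp (bracket_sp w' (axis 1 z)) w - act_der (bracket_inder w' (axis 1 z)) w) $ 1)
        + tr (\<lambda>z. (- act_sp (bracket_sp w' (axis 2 z)) w - act_der (bracket_inder w' (axis 2 z)) w) $ 2)
        = - (DIM('a) + 4) * om_V w w'"
      using om_skew[of "w $ 1" "w' $ 2"] om_skew[of "w $ 2" "w' $ 1"]
      by (simp add: act_sp_nth act_der_nth entry_bracket_sp bracket_inder_apply axis_def om_simps tp_simps
        tr_simps tr_om tr_tp2 om_V_def algebra_simps)
  qed
  with sp h show ?thesis
    using subspace_0[OF subspace_spV] subspace_0[OF subspace_inder]
    by (subst killing_eq) (simp_all add: envel_space_eq bracket_eq comm_simps bracket_sp_simps bracket_inder_simps
        act_sp_simps act_der_simps algebra_simps del: bracket.simps)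
qed

lemma om_V_nondegenerate:
  assumes "\<And>w'. om_V w w' = 0"
  shows "w = 0"
proof -
  have "om (w $ 1) y = 0" "om (w $ 2) y = 0" for y
    using assms[of "axis 2 y"] assms[of "axis 1 y"] by (simp_all add: om_V_def axis_def om_simps)
  then show ?thesis using om_nondegenerate by (simp add: vec_eq_iff forall_2)
qed

text \<open>The metric of the theorem, with the Killing form evaluated.\<close>

fun metric_form :: "'a envel \<Rightarrow> 'a envel \<Rightarrow> real" where
  "metric_form (\<gamma>, d, w) (\<gamma>', d', w') = - trace_sp \<gamma> \<gamma>' / 2 + om_V w w' / 2"

lemma metric_form_nondegenerate:
  assumes X: "X \<in> m_space" and 0: "\<And>Y. Y \<in> m_space \<Longrightarrow> metric_form X Y = 0"
  shows "X = 0"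
proof -
  obtain \<gamma> w where X: "X = (\<gamma>, 0, w)" "\<gamma> \<in> spV" using X by (auto simp: m_space_def)
  have "om_V w w' = 0" for w'
    using 0[of "(0, 0, w')"] subspace_0[OF subspace_spV] by (simp add: X m_space_def trace_sp_def entry_simps)
  then have w: "w = 0" by (rule om_V_nondegenerate)
  have g: "trace_sp \<gamma> \<gamma>' = 0" if "\<gamma>' \<in> spV" for \<gamma>'
    using 0[of "(\<gamma>', 0, 0)"] that by (simp add: X w m_space_def om_V_def om_simps)
  have "entry \<gamma> i j = 0" for i j
    using g[of "sp_basis 0"] g[of "sp_basis 1"] g[of "sp_basis 2"] X(2) exhaust_2[of i] exhaust_2[of j]
    by (auto simp: spV_iff entry_sp_basis trace_sp_def)
  then have "\<gamma> = 0" by (intro entry_eqI) (simp add: entry_simps)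
  then show ?thesis by (simp add: X w zero_prod_def)
qed

lemma metric_form_bilinear: "bilinear metric_form"
  unfolding bilinear_def
  by (auto intro!: linearI simp: trace_sp_def om_V_def entry_simps om_simps field_simps)

lemma metric_form_sym: "metric_form X Y = metric_form Y X"
proof (cases X; cases Y)
  fix \<gamma> d w \<gamma>' d' w' assume "X = (\<gamma>, d, w)" "Y = (\<gamma>', d', w')"
  then show ?thesis
    using om_skew[of "w $ 1" "w' $ 2"] om_skew[of "w $ 2" "w' $ 1"]
    by (simp add: trace_sp_def om_V_def algebra_simps)
qed

section \<open>Connection and Ricci tensor at the base point\<close>

text \<open>The Koszul formula gives half the \<open>\<mm>\<close>-part of the bracket on two arguments from the same
  summand, \<open>0\<close> on \<open>\<ss>\<pp>(V) \<times> (V \<otimes> T)\<close> and the full bracket on \<open>(V \<otimes> T) \<times> \<ss>\<pp>(V)\<close>.\<close>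

fun koszul :: "'a envel \<Rightarrow> 'a envel \<Rightarrow> 'a envel" where
  "koszul (\<gamma>, d, w) (\<gamma>', d', w') = ((1/2) *\<^sub>R (comm \<gamma> \<gamma>' + bracket_sp w w'), 0, - act_sp \<gamma>' w)"

lemma koszul_bilinear: "bilinear koszul"
  unfolding bilinear_def
  by (auto intro!: linearI simp: comm_simps bracket_sp_simps act_sp_simps algebra_simps)

lemma koszul_m: "X \<in> m_space \<Longrightarrow> Y \<in> m_space \<Longrightarrow> koszul X Y \<in> m_space"
  by (auto simp: m_space_def intro!: subspace_mul[OF subspace_spV] subspace_add[OF subspace_spV]
      comm_spV bracket_sp_spV)

text \<open>On arguments from the same summand, antisymmetrising doubles half of the skew bracket.
  On mixed arguments only one of the two terms is non-zero, and it already is the full bracket up to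
  sign.\<close>

lemma koszul_torsion:
  assumes "X \<in> m_space" "Y \<in> m_space"
  shows "koszul X Y - koszul Y X = proj_m (bracket om tp X Y)"
proof -
  obtain \<gamma> w \<gamma>' w' where XY: "X = (\<gamma>, 0, w)" "Y = (\<gamma>', 0, w')"
    using assms by (auto simp: m_space_def)
  have sk: "om (w' $ i) (w $ j) = - om (w $ j) (w' $ i)" for i j by (rule om_skew)
  have s: "bracket_sp w' w = - bracket_sp w w'"
  proof (rule entry_eqI)
    fix i j show "entry (bracket_sp w' w) i j = entry (- bracket_sp w w') i j"
      using exhaust_2[of i] exhaust_2[of j] by (auto simp: entry_bracket_sp entry_simps sk)
  qed
  have c: "comm \<gamma>' \<gamma> = - comm \<gamma> \<gamma>'" by (simp add: comm_def)
  have "(1/2) *\<^sub>R x - (1/2) *\<^sub>R (- x) = x" for x :: "(real^2) \<Rightarrow>\<^sub>L (real^2)"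
    by (simp add: scaleR_left.add[symmetric])
  from this[of "comm \<gamma> \<gamma>' + bracket_sp w w'"] show ?thesis
    by (simp add: XY s c bracket_eq act_der_simps algebra_simps del: bracket.simps)
qed

text \<open>For three arguments in sp(V) this is invariance of the trace form. With \<open>X\<close>
  in V \<otimes> T, the identity tr([w, w']\<gamma>) = -2
  \<open>om_V w' (act_sp \<gamma> w)\<close>, where [w, w'] is \<open>bracket_sp w w'\<close>,
  balances the half bracket against the full one.\<close>

lemma koszul_metric:
  assumes "X \<in> m_space" "Y \<in> m_space" "Z \<in> m_space"
  shows "metric_form (koszul X Y) Z + metric_form Y (koszul X Z) = 0"
proof -
  obtain \<gamma> w \<gamma>' w' \<gamma>'' w'' where
    "X = (\<gamma>, 0, w)" "Y = (\<gamma>', 0, w')" "Z = (\<gamma>'', 0, w'')" "\<gamma> \<in> spV" "\<gamma>' \<in> spV" "\<gamma>'' \<in> spV"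
    using assms by (auto simp: m_space_def)
  moreover have "om (w' $ i) (w $ j) = - om (w $ j) (w' $ i)" for i j by (rule om_skew)
  ultimately show ?thesis
    by (simp add: trace_sp_def om_V_def comm_def entry_simps entry_bracket_sp act_sp_nth om_simps spV_iff field_simps)
qed

text \<open>Inner derivations are skew for \<open>om\<close>, which gives invariance of
  \<open>bracket_sp\<close>. They act on the T factor of V \<otimes> T and therefore commute with
  sp(V), which acts on the V factor.\<close>

lemma koszul_invariant:
  assumes "D \<in> h_space tp" "X \<in> m_space" "Y \<in> m_space"
  shows "bracket om tp D (koszul X Y) = koszul (bracket om tp D X) Y + koszul X (bracket om tp D Y)"
proof -
  obtain d \<gamma> w \<gamma>' w' where *: "D = (0, d, 0)" "d \<in> inder tp" "X = (\<gamma>, 0, w)" "Y = (\<gamma>', 0, w')"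
    using assms by (auto simp: m_space_def h_space_def)
  have "bracket_sp (act_der d w) w' = - bracket_sp w (act_der d w')"
    by (simp add: bracket_sp_def sum_2 act_der_nth inder_skew[OF *(2)])
  moreover have "act_der d (act_sp \<gamma>' w) = act_sp \<gamma>' (act_der d w)"
    by (simp add: vec_eq_iff act_der_nth act_sp_nth blinfun.bilinear_simps)
  ultimately show ?thesis
    by (simp add: * bracket_eq comm_simps bracket_sp_simps bracket_inder_simps act_sp_simps act_der_simps del: bracket.simps)
qed

lemma subspace_m: "subspace (m_space :: 'a envel set)"
  by (auto simp: m_space_eq intro!: subspace_Times subspace_spV)

lemma bracket_h_m: "D \<in> h_space tp \<Longrightarrow> X \<in> m_space \<Longrightarrow> bracket om tp D X \<in> m_space"
  by (auto simp: m_space_def h_space_def bracket_eq comm_simps bracket_sp_simps bracket_inder_simps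
      act_sp_simps simp del: bracket.simps intro: subspace_0[OF subspace_spV])

text \<open>Existence is the preceding lemmas on \<open>koszul\<close>; uniqueness is the classical
  argument that a tensor symmetric in one pair of arguments and skew in another vanishes. Agreement
  of \<open>go\<close> with \<open>metric_form\<close> is required only on \<open>m_space\<close>,
  where the geometric metric can be computed.\<close>

lemma lc_map_eq:
  assumes go: "\<And>X Y. X \<in> m_space \<Longrightarrow> Y \<in> m_space \<Longrightarrow> go X Y = metric_form X Y"
    and XY: "X \<in> m_space" "Y \<in> m_space"
  shows "lc_map om tp go X Y = koszul X Y"
proof -
  \<comment> \<open>\<open>koszul\<close> need not vanish off \<open>m_space\<close>, so it is cut
    off to meet the convention of \<open>levi_civita_map\<close>.\<close>
  define \<alpha>0 where "\<alpha>0 X Y = (if X \<in> m_space \<and> Y \<in> m_space then koszul X Y else 0)" for X Y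
  have m: "r *\<^sub>R X + s *\<^sub>R Y \<in> m_space" if "X \<in> m_space" "Y \<in> m_space" for r s and X Y :: "'a envel"
    using that by (simp add: subspace_add[OF subspace_m] subspace_mul[OF subspace_m])
  have koszul: "levi_civita_map om tp go \<alpha>0"
    unfolding levi_civita_map_def
    using m koszul_m bracket_h_m koszul_invariant koszul_torsion koszul_metric
    by (simp add: \<alpha>0_def go bilinear_ladd[OF koszul_bilinear] bilinear_radd[OF koszul_bilinear]
        bilinear_lmul[OF koszul_bilinear] bilinear_rmul[OF koszul_bilinear])
  have unique: "\<alpha> = \<alpha>0" if \<alpha>: "levi_civita_map om tp go \<alpha>" for \<alpha>
  proof (intro ext)
    fix X Y
    show "\<alpha> X Y = \<alpha>0 X Y"
    proof (cases "X \<in> m_space \<and> Y \<in> m_space")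
      case False
      then have "\<alpha> X Y = 0" using \<alpha> unfolding levi_civita_map_def by blast
      then show ?thesis using False by (auto simp: \<alpha>0_def)
    next
      case True
      \<comment> \<open>Equal torsion makes the difference symmetric; compatibility of both maps
        with the metric makes it skew in its last two slots.\<close>
      define \<beta> where "\<beta> X Y = \<alpha> X Y - \<alpha>0 X Y" for X Y
      have \<beta>m: "\<beta> X Y \<in> m_space" if "X \<in> m_space" "Y \<in> m_space" for X Y
        using \<alpha> koszul that by (auto simp: levi_civita_map_def \<beta>_def intro: subspace_diff[OF subspace_m])
      have sym: "\<beta> X Y = \<beta> Y X" if "X \<in> m_space" "Y \<in> m_space" for X Y
      proof -
        have "\<alpha> X Y - \<alpha> Y X = \<alpha>0 X Y - \<alpha>0 Y X"
          using \<alpha> koszul that by (simp add: levi_civita_map_def)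
        then show ?thesis by (simp add: \<beta>_def algebra_simps)
      qed
      have skew: "metric_form (\<beta> X Y) Z = - metric_form (\<beta> X Z) Y"
        if "X \<in> m_space" "Y \<in> m_space" "Z \<in> m_space" for X Y Z
      proof -
        have am: "\<alpha> X Y \<in> m_space" "\<alpha>0 X Y \<in> m_space" "\<alpha> X Z \<in> m_space" "\<alpha>0 X Z \<in> m_space"
          using \<alpha> koszul that by (auto simp: levi_civita_map_def)
        have "go (\<alpha> X Y) Z + go Y (\<alpha> X Z) = 0" "go (\<alpha>0 X Y) Z + go Y (\<alpha>0 X Z) = 0"
          using \<alpha> koszul that by (simp_all add: levi_civita_map_def)
        then show ?thesis
          using that am metric_form_sym[of Y]
          by (simp add: go \<beta>_def bilinear_lsub[OF metric_form_bilinear])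
      qed
      \<comment> \<open>Alternating the two symmetries returns to the same triple after three skew
        exchanges, that is, with a minus sign.\<close>
      have "metric_form (\<beta> X Y) Z = 0" if "X \<in> m_space" "Y \<in> m_space" "Z \<in> m_space" for X Y Z
      proof -
        have "metric_form (\<beta> X Y) Z = - metric_form (\<beta> Z X) Y" using skew[of X Y Z] sym[of X Z] that by simp
        also have "\<dots> = metric_form (\<beta> Y Z) X" using skew[of Z X Y] sym[of Z Y] that by simp
        also have "\<dots> = - metric_form (\<beta> X Y) Z" using skew[of Y Z X] sym[of Y X] that by simp
        finally show ?thesis by simp
      qed
      then have "\<beta> X Y = 0" using True \<beta>m by (intro metric_form_nondegenerate) auto
      then show ?thesis by (simp add: \<beta>_def)
    qed
  qed
  have "lc_map om tp go = \<alpha>0"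
    unfolding lc_map_def using koszul unique by (rule the_equality)
  then show ?thesis using XY by (simp add: \<alpha>0_def)
qed

section \<open>Curvature and its Ricci trace\<close>

lemma linear_proj: "linear proj_m" "linear proj_h"
  by (auto intro!: linearI)

lemma proj_m_in: "X \<in> envel_space tp \<Longrightarrow> proj_m X \<in> m_space"
  and proj_h_in: "X \<in> envel_space tp \<Longrightarrow> proj_h X \<in> h_space tp"
  by (auto simp: envel_space_def m_space_def h_space_def)

lemma m_envel: "X \<in> m_space \<Longrightarrow> X \<in> envel_space tp"
  using subspace_0[OF subspace_inder] by (auto simp: m_space_def envel_space_def)

text \<open>The curvature with \<open>koszul\<close> in place of \<open>lc_map\<close>. Unlike the
  latter, which is cut off outside \<open>m_space\<close>, it is globally linear in
  \<open>Z\<close>, as \<open>trace_on_m\<close> demands.\<close>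

definition curvature_form :: "'a envel \<Rightarrow> 'a envel \<Rightarrow> 'a envel \<Rightarrow> 'a envel" where
  "curvature_form Z X Y = koszul Z (koszul X Y) - koszul X (koszul Z Y) - koszul (proj_m (bracket om tp Z X)) Y
     - bracket om tp (proj_h (bracket om tp Z X)) Y"

lemma curvature_form_linear: "linear (\<lambda>Z. curvature_form Z X Y)"
  by (rule linearI)
    (simp_all add: curvature_form_def linear_add[OF bracket_linear1] linear_scale[OF bracket_linear1]
      linear_add[OF linear_proj(1)] linear_add[OF linear_proj(2)]
      linear_scale[OF linear_proj(1)] linear_scale[OF linear_proj(2)]
      bilinear_ladd[OF koszul_bilinear] bilinear_radd[OF koszul_bilinear]
      bilinear_lmul[OF koszul_bilinear] bilinear_rmul[OF koszul_bilinear] algebra_simps del: bracket.simps)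

lemma curvature_form_m:
  assumes "X \<in> m_space" "Y \<in> m_space" "Z \<in> m_space"
  shows "curvature_form Z X Y \<in> m_space"
proof -
  have "bracket om tp Z X \<in> envel_space tp" using assms by (simp add: bracket_envel m_envel)
  then show ?thesis
    unfolding curvature_form_def using assms
    by (intro subspace_diff[OF subspace_m] koszul_m bracket_h_m proj_m_in proj_h_in)
qed

text \<open>Neither block alone is a multiple of the metric. The 3/2 \<open>om_V\<close> from the
  sp(V) block cancels against the V \<otimes> T block, and with d = \<open>DIM('a)\<close> the total
  is (d+1)(\<open>om_V w w'\<close> - tr(\<gamma>\<gamma>')), which is 2d+2 times
  \<open>metric_form\<close>.\<close>

lemma ricci_eq:
  assumes go: "\<And>X Y. X \<in> m_space \<Longrightarrow> Y \<in> m_space \<Longrightarrow> go X Y = metric_form X Y"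
    and XY: "X \<in> m_space" "Y \<in> m_space"
  shows "ricci_o om tp go X Y = (2 * DIM('a) + 2) * metric_form X Y"
proof -
  have "ricci_o om tp go X Y = trace_on m_space (\<lambda>Z. curvature_form Z X Y)"
    unfolding ricci_o_def
  proof (rule trace_on_cong[OF subspace_m])
    fix Z :: "'a envel" assume Z: "Z \<in> m_space"
    then have "bracket om tp Z X \<in> envel_space tp" using XY by (simp add: bracket_envel m_envel)
    then show "curvature_o om tp go Z X Y = curvature_form Z X Y"
      using XY Z by (simp add: curvature_o_def curvature_form_def lc_map_eq[OF go] koszul_m proj_m_in)
  qed
  also have "\<dots> = trace_on spV (\<lambda>\<gamma>. fst (curvature_form (\<gamma>, 0, 0) X Y)) + tr (\<lambda>w. snd (snd (curvature_form (0, 0, w) X Y)))"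
    by (rule trace_on_m[OF curvature_form_linear curvature_form_m]) (use XY in auto)
  also have "\<dots> = (2 * DIM('a) + 2) * metric_form X Y"
  proof -
    obtain \<gamma> w \<gamma>' w' where *: "X = (\<gamma>, 0, w)" "Y = (\<gamma>', 0, w')" "\<gamma> \<in> spV" "\<gamma>' \<in> spV"
      using XY by (auto simp: m_space_def)
    have sk: "om (w' $ i) (w $ j) = - om (w $ j) (w' $ i)" for i j by (rule om_skew)
    have "linear (\<lambda>\<zeta>. (\<zeta>, 0, 0) :: 'a envel)" "linear (\<lambda>z. (0, 0, z) :: 'a envel)"
      by (auto intro!: linearI)
    then have l: "linear (\<lambda>\<zeta>. fst (curvature_form (\<zeta>, 0, 0) X Y))" "linear (\<lambda>z. snd (snd (curvature_form (0, 0, z) X Y)))"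
      using linear_compose[OF linear_compose[OF _ curvature_form_linear[of X Y]]]
        linear_compose[OF linear_snd linear_snd] linear_fst
      by (auto simp: o_def)
    have even: "fst (curvature_form (\<zeta>, 0, 0) X Y) = (1/4) *\<^sub>R comm \<zeta> (comm \<gamma> \<gamma>' + bracket_sp w w')
        - (1/4) *\<^sub>R comm \<gamma> (comm \<zeta> \<gamma>') - (1/2) *\<^sub>R (comm (comm \<zeta> \<gamma>) \<gamma>' + bracket_sp (act_sp \<zeta> w) w')" for \<zeta>
      by (simp add: * curvature_form_def bracket_eq comm_simps bracket_sp_simps bracket_inder_simps act_sp_simps act_der_simps
          del: bracket.simps)
    have odd: "snd (snd (curvature_form (0, 0, z) X Y)) = - (1/2) *\<^sub>R act_sp (comm \<gamma> \<gamma>' + bracket_sp w w') z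
        + (1/2) *\<^sub>R act_sp (bracket_sp z w') w - act_sp \<gamma>' (act_sp \<gamma> z) - act_der (bracket_inder z w) w'" for z
      by (simp add: * curvature_form_def bracket_eq comm_simps bracket_sp_simps bracket_inder_simps act_sp_simps act_der_simps
          del: bracket.simps)
    \<comment> \<open>The first term of \<open>even\<close> is trace-free. As ad \<gamma> ad
      \<gamma>' has trace 4 tr(\<gamma>\<gamma>'), the next two commutator terms give 1 - 2 = -1,
      and the last term gives 3/2.\<close>
    have "trace_on spV (\<lambda>\<zeta>. fst (curvature_form (\<zeta>, 0, 0) X Y)) = - trace_sp \<gamma> \<gamma>' + 3 / 2 * om_V w w'"
    proof (subst trace_on_spV[OF l(1)])
      fix \<zeta> :: "(real^2) \<Rightarrow>\<^sub>L (real^2)" assume "\<zeta> \<in> spV"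
      then have "curvature_form (\<zeta>, 0, 0) X Y \<in> m_space" using XY by (intro curvature_form_m) (auto simp: m_space_def)
      then show "fst (curvature_form (\<zeta>, 0, 0) X Y) \<in> spV" by (auto simp: m_space_def)
    qed (use *(3,4) in \<open>simp add: even entry_simps entry_bracket_sp entry_sp_basis act_sp_nth om_simps comm_def
      trace_sp_def om_V_def spV_iff algebra_simps\<close>)
    \<comment> \<open>The summand d+1 comes from the inner derivation in \<open>odd\<close>, through
      the traces of the triple product.\<close>
    moreover have "tr (\<lambda>z. snd (snd (curvature_form (0, 0, z) X Y)))
        = - real DIM('a) * trace_sp \<gamma> \<gamma>' + (real DIM('a) + 1) * om_V w w' - 3 / 2 * om_V w w'"
      by (subst tr_vec2[OF l(2)])
        (use *(3,4) in \<open>simp add: odd entry_simps entry_bracket_sp bracket_inder_apply act_sp_nth act_der_nth axis_def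
          om_simps tp_simps comm_def trace_sp_def om_V_def sk spV_iff tr_simps tr_om tr_tp1 tr_tp2 algebra_simps\<close>)
    ultimately show ?thesis by (simp add: * algebra_simps)
  qed
  finally show ?thesis .
qed

end

section \<open>Smooth maps and tangent vectors\<close>

lemma Ck_on_subset: "Ck_on k S f \<Longrightarrow> T \<subseteq> S \<Longrightarrow> Ck_on k T f"
  by (induction k arbitrary: f) (auto intro: continuous_on_subset)

lemma Ck_on_SucD: "Ck_on (Suc k) S f \<Longrightarrow> Ck_on k S f"
  by (induction k arbitrary: f)
    (auto intro!: continuous_at_imp_continuous_on differentiable_imp_continuous_within)

text \<open>Openness carries equality on \<open>S\<close> over to a neighbourhood of each point,
  hence to all derivatives.\<close>

lemma Ck_on_cong:
  assumes "open S"
  shows "Ck_on k S f \<Longrightarrow> (\<And>x. x \<in> S \<Longrightarrow> f x = g x) \<Longrightarrow> Ck_on k S g"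
proof (induction k arbitrary: f g)
  case 0
  then show ?case using continuous_on_cong[of S S f g] by simp
next
  case (Suc k)
  have d: "g differentiable (at x)" if x: "x \<in> S" for x
  proof -
    obtain D where "(f has_derivative D) (at x)"
      using Suc.prems x by (auto simp: differentiable_def)
    then have "(g has_derivative D) (at x)"
      using has_derivative_transform_within_open[OF _ assms x] Suc.prems(2) by metis
    then show ?thesis by (auto simp: differentiable_def)
  qed
  have "Ck_on k S (\<lambda>x. frechet_derivative g (at x) v)" for v
  proof (rule Suc.IH)
    show "Ck_on k S (\<lambda>x. frechet_derivative f (at x) v)" using Suc.prems by simp
    show "frechet_derivative f (at x) v = frechet_derivative g (at x) v" if "x \<in> S" for x
      using frechet_derivative_transform_within_open[of f x S g] Suc.prems that assms by auto
  qed
  with d show ?case by simp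
qed

lemma Ck_on_local:
  assumes "\<And>x. x \<in> S \<Longrightarrow> \<exists>U. open U \<and> x \<in> U \<and> Ck_on k U f"
  shows "Ck_on k S f"
  using assms
proof (induction k arbitrary: f)
  case 0
  have "continuous (at x) f" if "x \<in> S" for x
    using 0[OF that] by (auto simp: continuous_on_eq_continuous_at)
  then show ?case by (simp add: continuous_at_imp_continuous_on)
next
  case (Suc k)
  show ?case
  proof (simp, intro conjI ballI allI)
    show "f differentiable (at x)" if "x \<in> S" for x using Suc.prems[OF that] by auto
    show "Ck_on k S (\<lambda>x. frechet_derivative f (at x) v)" for v
    proof (rule Suc.IH)
      fix x assume "x \<in> S"
      from Suc.prems[OF this] show "\<exists>U. open U \<and> x \<in> U \<and> Ck_on k U (\<lambda>x. frechet_derivative f (at x) v)"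
        by auto
    qed
  qed
qed

lemma Ck_on_const: "Ck_on k S (\<lambda>x. c)"
  by (induction k arbitrary: c) auto

lemma Ck_on_add:
  assumes "open S"
  shows "Ck_on k S f \<Longrightarrow> Ck_on k S g \<Longrightarrow> Ck_on k S (\<lambda>x. f x + g x)"
proof (induction k arbitrary: f g)
  case 0
  then show ?case by (simp add: continuous_on_add)
next
  case (Suc k)
  have "Ck_on k S (\<lambda>x. frechet_derivative (\<lambda>x. f x + g x) (at x) v)" for v
  proof (rule Ck_on_cong[OF assms Suc.IH])
    fix x assume "x \<in> S"
    then have "((\<lambda>x. f x + g x) has_derivative
        (\<lambda>v. frechet_derivative f (at x) v + frechet_derivative g (at x) v)) (at x)"
      using Suc.prems by (auto intro!: has_derivative_add simp: frechet_derivative_works[symmetric])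
    from frechet_derivative_at[OF this]
    show "frechet_derivative f (at x) v + frechet_derivative g (at x) v
        = frechet_derivative (\<lambda>x. f x + g x) (at x) v" by metis
  qed (use Suc.prems in auto)
  then show ?case using Suc.prems by simp
qed

lemma Ck_on_sum:
  assumes "open S" "\<And>i. i \<in> I \<Longrightarrow> Ck_on k S (f i)"
  shows "Ck_on k S (\<lambda>x. \<Sum>i\<in>I. f i x)"
  using assms(2)
  by (induction I rule: infinite_finite_induct) (auto intro: Ck_on_const Ck_on_add assms(1))

lemma Ck_on_bounded_linear:
  assumes "open S" "bounded_linear L"
  shows "Ck_on k S f \<Longrightarrow> Ck_on k S (\<lambda>x. L (f x))"
proof (induction k arbitrary: f)
  case 0
  then show ?case using bounded_linear.continuous_on[OF assms(2)] by simp
next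
  case (Suc k)
  have d: "((\<lambda>x. L (f x)) has_derivative (\<lambda>v. L (frechet_derivative f (at x) v))) (at x)"
    if "x \<in> S" for x
    using Suc.prems that
    by (auto intro!: bounded_linear.has_derivative[OF assms(2)] simp: frechet_derivative_works[symmetric])
  have "Ck_on k S (\<lambda>x. frechet_derivative (\<lambda>x. L (f x)) (at x) v)" for v
  proof (rule Ck_on_cong[OF assms(1) Suc.IH])
    fix x assume "x \<in> S"
    from frechet_derivative_at[OF d[OF this]]
    show "L (frechet_derivative f (at x) v) = frechet_derivative (\<lambda>x. L (f x)) (at x) v" by metis
  qed (use Suc.prems in auto)
  then show ?case using d by (auto simp: differentiable_def)
qed

lemma Ck_on_scaleR:
  assumes "open S"
  shows "Ck_on k S f \<Longrightarrow> Ck_on k S g \<Longrightarrow> Ck_on k S (\<lambda>x. f x *\<^sub>R g x)"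
proof (induction k arbitrary: f g)
  case 0
  then show ?case by (simp add: continuous_on_scaleR)
next
  case (Suc k)
  have d: "((\<lambda>x. f x *\<^sub>R g x) has_derivative
      (\<lambda>v. f x *\<^sub>R frechet_derivative g (at x) v + frechet_derivative f (at x) v *\<^sub>R g x)) (at x)"
    if "x \<in> S" for x
    using Suc.prems that
    by (auto intro!: has_derivative_scaleR simp: frechet_derivative_works[symmetric])
  have "Ck_on k S (\<lambda>x. frechet_derivative (\<lambda>x. f x *\<^sub>R g x) (at x) v)" for v
  proof (rule Ck_on_cong[OF assms Ck_on_add[OF assms Suc.IH Suc.IH]])
    fix x assume "x \<in> S"
    from frechet_derivative_at[OF d[OF this]]
    show "f x *\<^sub>R frechet_derivative g (at x) v + frechet_derivative f (at x) v *\<^sub>R g x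
        = frechet_derivative (\<lambda>x. f x *\<^sub>R g x) (at x) v" by metis
  qed (use Suc.prems Ck_on_SucD[OF Suc.prems(1)] Ck_on_SucD[OF Suc.prems(2)] in auto)
  then show ?case using d by (auto simp: differentiable_def)
qed

text \<open>\<open>Ck_on\<close> controls derivatives in fixed directions only, while the chain rule
  differentiates \<open>g\<close> in a direction that moves with \<open>x\<close>. Expanding that
  direction in \<open>Basis\<close> gives a sum of products to which the induction hypothesis
  applies.\<close>

lemma Ck_on_compose:
  fixes f :: "'a::euclidean_space \<Rightarrow> 'b::euclidean_space"
  assumes "open S" "f ` S \<subseteq> T"
  shows "Ck_on k S f \<Longrightarrow> Ck_on k T g \<Longrightarrow> Ck_on k S (\<lambda>x. g (f x))"
proof (induction k arbitrary: g)
  case 0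
  then show ?case using continuous_on_compose2[of T g S f] assms(2) by simp
next
  case (Suc k)
  have d: "((\<lambda>x. g (f x)) has_derivative
      (\<lambda>v. frechet_derivative g (at (f x)) (frechet_derivative f (at x) v))) (at x)" if "x \<in> S" for x
    using Suc.prems that assms(2) diff_chain_at[of f _ x g]
    by (auto simp: frechet_derivative_works[symmetric] o_def image_subset_iff)
  have "Ck_on k S (\<lambda>x. frechet_derivative (\<lambda>x. g (f x)) (at x) v)" for v
  proof (rule Ck_on_cong[OF assms(1)])
    show "Ck_on k S (\<lambda>x. \<Sum>b\<in>Basis. (frechet_derivative f (at x) v \<bullet> b) *\<^sub>R frechet_derivative g (at (f x)) b)"
      using Suc.prems Ck_on_SucD[OF Suc.prems(1)]
      by (intro Ck_on_sum Ck_on_scaleR Suc.IH assms(1) Ck_on_bounded_linear[OF assms(1) bounded_linear_inner_left])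
        auto
    fix x assume x: "x \<in> S"
    have lin: "linear (frechet_derivative g (at (f x)))"
      using Suc.prems x assms(2) by (intro linear_frechet_derivative) auto
    have "frechet_derivative g (at (f x)) (frechet_derivative f (at x) v)
        = frechet_derivative g (at (f x)) (\<Sum>b\<in>Basis. (frechet_derivative f (at x) v \<bullet> b) *\<^sub>R b)"
      by (simp add: euclidean_representation)
    also have "\<dots> = (\<Sum>b\<in>Basis. (frechet_derivative f (at x) v \<bullet> b) *\<^sub>R frechet_derivative g (at (f x)) b)"
      by (simp add: linear_sum[OF lin] linear_scale[OF lin])
    finally show "(\<Sum>b\<in>Basis. (frechet_derivative f (at x) v \<bullet> b) *\<^sub>R frechet_derivative g (at (f x)) b)
        = frechet_derivative (\<lambda>x. g (f x)) (at x) v"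
      using frechet_derivative_at[OF d[OF x]] by metis
  qed
  then show ?case using d by (auto simp: differentiable_def)
qed

section \<open>Smooth maps read in charts\<close>

lemma smooth_on_differentiable:
  assumes "smooth_on S f" "x \<in> S"
  shows "f differentiable (at x)"
proof -
  have "Ck_on (Suc 0) S f" using assms(1) unfolding smooth_on_def by blast
  then show ?thesis using assms(2) by simp
qed

lemma chart_inv_chart: "is_chart c \<Longrightarrow> p \<in> fst c \<Longrightarrow> chart_inv c (snd c p) = p"
  by (auto simp: is_chart_def chart_inv_def homeomorphism_def)

lemma open_chart_image:
  assumes c: "is_chart c" and U: "open U" "U \<subseteq> fst c"
  shows "open (snd c ` U)"
proof -
  have h: "homeomorphism (fst c) (snd c ` fst c) (snd c) (inv_into (fst c) (snd c))"
    and "open (snd c ` fst c)" using c by (auto simp: is_chart_def)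
  have "openin (top_of_set (snd c ` fst c)) (snd c ` U)"
    using homeomorphism_imp_open_map[OF h] U by (simp add: open_subset)
  from openin_open_trans[OF this \<open>open (snd c ` fst c)\<close>] show ?thesis .
qed

lemma smooth_map_on_Ck:
  assumes "smooth_map_on A B W F" "c \<in> A" "d \<in> B"
  shows "Ck_on k (snd c ` (fst c \<inter> W \<inter> F -` fst d)) (snd d \<circ> F \<circ> chart_inv c)"
  using assms unfolding smooth_map_on_def smooth_on_def by blast

lemma smooth_map_on_compose:
  fixes A :: "('m::topological_space, 'e::euclidean_space) chart set"
    and B :: "('n::topological_space, 'f::euclidean_space) chart set"
    and C :: "('k::topological_space, 'h::euclidean_space) chart set"
  assumes A: "\<And>c. c \<in> A \<Longrightarrow> is_chart c" and B: "smooth_atlas B"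
    and C: "\<And>c. c \<in> C \<Longrightarrow> open (fst c)"
    and F: "smooth_map_on A B W F" and G: "smooth_map_on B C W' G"
  shows "smooth_map_on A C (W \<inter> F -` W') (\<lambda>x. G (F x))"
  unfolding smooth_map_on_def
proof (intro conjI ballI)
  let ?W = "W \<inter> F -` W'"
  have oW: "open W" "open W'" and cF: "continuous_on W F" and cG: "continuous_on W' G"
    using F G by (auto simp: smooth_map_on_def)
  show o: "open ?W" using continuous_open_preimage[OF cF] oW by blast
  show cGF: "continuous_on ?W (\<lambda>x. G (F x))"
    by (rule continuous_on_compose2[OF cG]) (auto intro: continuous_on_subset[OF cF])
  fix c e assume ce: "c \<in> A" "e \<in> C"
  have oc: "open (fst c)" using A[OF ce(1)] by (simp add: is_chart_def)
  have oe: "open (?W \<inter> (\<lambda>x. G (F x)) -` fst e)"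
    using continuous_open_preimage[OF cGF o C[OF ce(2)]] .
  let ?P = "fst c \<inter> ?W \<inter> (\<lambda>x. G (F x)) -` fst e"
  have oP: "open ?P" using open_Int[OF oc oe] by (simp add: Int_assoc)
  show "smooth_on (snd c ` ?P) (snd e \<circ> (\<lambda>x. G (F x)) \<circ> chart_inv c)"
    unfolding smooth_on_def
  proof (intro conjI allI)
    show "open (snd c ` ?P)" using A[OF ce(1)] oP by (rule open_chart_image) auto
    fix k show "Ck_on k (snd c ` ?P) (snd e \<circ> (\<lambda>x. G (F x)) \<circ> chart_inv c)"
    proof (rule Ck_on_local)
      fix x assume "x \<in> snd c ` ?P"
      then obtain p where p: "p \<in> ?P" "x = snd c p" by blast
      \<comment> \<open>No single chart of the middle manifold need contain the whole image, so one
        is chosen around \<open>F p\<close> and the claim is proved near \<open>x\<close>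
        only.\<close>
      have "F p \<in> (\<Union>d\<in>B. fst d)" using B by (simp add: smooth_atlas_def)
      then obtain d where d: "d \<in> B" "F p \<in> fst d" by blast
      have od: "open (fst d)" using B d by (auto simp: smooth_atlas_def is_chart_def)
      have cd: "is_chart d" using B d by (auto simp: smooth_atlas_def)
      let ?Q = "?P \<inter> (W \<inter> F -` fst d)"
      have "open ?Q" using oP continuous_open_preimage[OF cF oW(1) od] by (rule open_Int)
      then have oU: "open (snd c ` ?Q)" using A[OF ce(1)] by (intro open_chart_image) auto
      have "Ck_on k (snd c ` (fst c \<inter> W \<inter> F -` fst d)) (snd d \<circ> F \<circ> chart_inv c)"
        by (rule smooth_map_on_Ck[OF F ce(1) d(1)])
      then have 1: "Ck_on k (snd c ` ?Q) (snd d \<circ> F \<circ> chart_inv c)"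
        by (rule Ck_on_subset) blast
      have 2: "Ck_on k (snd d ` (fst d \<inter> W' \<inter> G -` fst e)) (snd e \<circ> G \<circ> chart_inv d)"
        by (rule smooth_map_on_Ck[OF G d(1) ce(2)])
      have "Ck_on k (snd c ` ?Q) (\<lambda>x. (snd e \<circ> G \<circ> chart_inv d) ((snd d \<circ> F \<circ> chart_inv c) x))"
        by (rule Ck_on_compose[OF oU _ 1 2]) (auto simp: chart_inv_chart A[OF ce(1)])
      then have "Ck_on k (snd c ` ?Q) (snd e \<circ> (\<lambda>x. G (F x)) \<circ> chart_inv c)"
        by (rule Ck_on_cong[OF oU]) (auto simp: chart_inv_chart A[OF ce(1)] cd)
      then show "\<exists>U. open U \<and> x \<in> U \<and> Ck_on k U (snd e \<circ> (\<lambda>x. G (F x)) \<circ> chart_inv c)"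
        using oU p d by blast
    qed
  qed
qed

lemma smooth_map_on_cong:
  assumes A: "\<And>c. c \<in> A \<Longrightarrow> is_chart c" and B: "\<And>c. c \<in> B \<Longrightarrow> open (fst c)"
    and F: "smooth_map_on A B W F" and W': "open W'" "W' \<subseteq> W" and eq: "\<And>x. x \<in> W' \<Longrightarrow> F x = G x"
  shows "smooth_map_on A B W' G"
  unfolding smooth_map_on_def
proof (intro conjI ballI)
  show "open W'" by fact
  have "continuous_on W' F" using F W' by (auto simp: smooth_map_on_def intro: continuous_on_subset)
  then show cG: "continuous_on W' G" using eq by (simp cong: continuous_on_cong)
  fix c d assume cd: "c \<in> A" "d \<in> B"
  let ?P = "fst c \<inter> W' \<inter> G -` fst d"
  have "open (fst c)" using A[OF cd(1)] by (simp add: is_chart_def)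
  then have "open ?P"
    using continuous_open_preimage[OF cG W'(1) B[OF cd(2)]] by (simp add: Int_assoc open_Int)
  then have o: "open (snd c ` ?P)" using A[OF cd(1)] by (intro open_chart_image) auto
  have "Ck_on k (snd c ` ?P) (snd d \<circ> F \<circ> chart_inv c)" for k
    using W'(2) eq by (intro Ck_on_subset[OF smooth_map_on_Ck[OF F cd]]) auto
  then have "Ck_on k (snd c ` ?P) (snd d \<circ> G \<circ> chart_inv c)" for k
    by (rule Ck_on_cong[OF o]) (auto simp: chart_inv_chart A[OF cd(1)] eq)
  with o show "smooth_on (snd c ` ?P) (snd d \<circ> G \<circ> chart_inv c)" by (simp add: smooth_on_def)
qed

lemma smooth_atlas_chart: "smooth_atlas A \<Longrightarrow> c \<in> A \<Longrightarrow> is_chart c"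
  by (simp add: smooth_atlas_def)

lemma smooth_atlas_open: "smooth_atlas A \<Longrightarrow> c \<in> A \<Longrightarrow> open (fst c)"
  by (simp add: smooth_atlas_def is_chart_def)

lemma smooth_atlas_cover:
  assumes "smooth_atlas A"
  obtains c where "c \<in> A" "p \<in> fst c"
proof -
  have "p \<in> (\<Union>c\<in>A. fst c)" using assms by (simp add: smooth_atlas_def)
  then show ?thesis using that by blast
qed

lemma std_atlas_open: "c \<in> std_atlas \<Longrightarrow> open (fst c)"
  by (simp add: std_atlas_def)

lemma smooth_at_compose:
  assumes "smooth_atlas A" "smooth_atlas B" "smooth_map_on A B W F" "p \<in> W" "smooth_at B (F p) f"
  shows "smooth_at A p (f \<circ> F)"
proof -
  obtain W' where W': "F p \<in> W'" "smooth_map_on B std_atlas W' f"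
    using assms(5) by (auto simp: smooth_at_def)
  have "smooth_map_on A std_atlas (W \<inter> F -` W') (\<lambda>x. f (F x))"
    by (rule smooth_map_on_compose[OF _ assms(2) _ assms(3) W'(2)])
      (simp_all add: smooth_atlas_chart[OF assms(1)] std_atlas_open)
  moreover have "p \<in> W \<inter> F -` W'" using assms(4) W'(1) by simp
  ultimately show ?thesis
    unfolding smooth_at_def o_def by (intro exI conjI)
qed

section \<open>Tangent vectors and differentials\<close>

lemma differentiable_in_charts:
  assumes "smooth_map_on A B W F" "c \<in> A" "d \<in> B" "p \<in> fst c" "p \<in> W" "F p \<in> fst d"
  shows "(snd d \<circ> F \<circ> chart_inv c) differentiable (at (snd c p))"
proof -
  have "smooth_on (snd c ` (fst c \<inter> W \<inter> F -` fst d)) (snd d \<circ> F \<circ> chart_inv c)"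
    using assms(1-3) unfolding smooth_map_on_def by blast
  then show ?thesis by (rule smooth_on_differentiable) (use assms(4-6) in blast)
qed

lemma differentiable_in_chart:
  assumes "smooth_at A p f" "c \<in> A" "p \<in> fst c"
  shows "(f \<circ> chart_inv c) differentiable (at (snd c p))"
proof -
  obtain W where W: "p \<in> W" "smooth_map_on A std_atlas W f"
    using assms(1) by (auto simp: smooth_at_def)
  show ?thesis
    using differentiable_in_charts[OF W(2) assms(2) _ assms(3) W(1), of "(UNIV, id)"]
    by (simp add: std_atlas_def)
qed

text \<open>The chain rule: near \<open>snd c p\<close>, the function \<open>f \<circ> F\<close> in
  the chart \<open>c\<close> is \<open>f\<close> in the chart \<open>d\<close> after the coordinate
  expression of \<open>F\<close>. On functions that are not smooth at \<open>F p\<close>, both sides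
  are 0 by convention.\<close>

lemma coord_vec_push:
  assumes A: "smooth_atlas A" and B: "smooth_atlas B" and F: "smooth_map_on A B W F"
    and c: "c \<in> A" "p \<in> fst c" and p: "p \<in> W" and d: "d \<in> B" "F p \<in> fst d"
  shows "differential B (F p) F (coord_vec A c p u)
    = coord_vec B d (F p) (frechet_derivative (snd d \<circ> F \<circ> chart_inv c) (at (snd c p)) u)"
proof
  fix f
  show "differential B (F p) F (coord_vec A c p u) f
    = coord_vec B d (F p) (frechet_derivative (snd d \<circ> F \<circ> chart_inv c) (at (snd c p)) u) f"
  proof (cases "smooth_at B (F p) f")
    case False
    then show ?thesis by (simp add: differential_def coord_vec_def)
  next
    case True
    have sm: "smooth_at A p (f \<circ> F)" by (rule smooth_at_compose[OF A B F p True])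
    note ic = smooth_atlas_chart[OF A c(1)] and id = smooth_atlas_chart[OF B d(1)]
    have d1: "(snd d \<circ> F \<circ> chart_inv c) differentiable (at (snd c p))"
      by (rule differentiable_in_charts[OF F c(1) d(1) c(2) p d(2)])
    have e: "(snd d \<circ> F \<circ> chart_inv c) (snd c p) = snd d (F p)"
      by (simp add: chart_inv_chart[OF ic c(2)])
    have d2: "(f \<circ> chart_inv d) differentiable (at (snd d (F p)))"
      by (rule differentiable_in_chart[OF True d])
    let ?P = "fst c \<inter> (W \<inter> F -` fst d)"
    have "open ?P"
      using F continuous_open_preimage[of W F "fst d"] smooth_atlas_open[OF A c(1)] smooth_atlas_open[OF B d(1)]
      by (auto simp: smooth_map_on_def intro!: open_Int)
    then have "open (snd c ` ?P)" using ic by (intro open_chart_image) auto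
    moreover have "snd c p \<in> snd c ` ?P" using c p d by blast
    moreover have "(f \<circ> F \<circ> chart_inv c) x = ((f \<circ> chart_inv d) \<circ> (snd d \<circ> F \<circ> chart_inv c)) x"
      if "x \<in> snd c ` ?P" for x
      using that by (auto simp: chart_inv_chart[OF ic] chart_inv_chart[OF id])
    ultimately have "frechet_derivative (f \<circ> F \<circ> chart_inv c) (at (snd c p))
        = frechet_derivative ((f \<circ> chart_inv d) \<circ> (snd d \<circ> F \<circ> chart_inv c)) (at (snd c p))"
      using frechet_derivative_transform_within_open[OF differentiable_in_chart[OF sm c]] by blast
    also have "\<dots> = frechet_derivative (f \<circ> chart_inv d) (at (snd d (F p)))
        \<circ> frechet_derivative (snd d \<circ> F \<circ> chart_inv c) (at (snd c p))"
      using frechet_derivative_compose[OF d1, of "f \<circ> chart_inv d"] d2 e by simp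
    finally show ?thesis
      using True sm by (simp add: differential_def coord_vec_def)
  qed
qed

lemma tangent_push:
  assumes A: "smooth_atlas A" and B: "smooth_atlas B" and F: "smooth_map_on A B W F" "p \<in> W"
    and v: "v \<in> tangent_space A p"
  shows "differential B (F p) F v \<in> tangent_space B (F p)"
proof -
  obtain c u where c: "c \<in> A" "p \<in> fst c" "v = coord_vec A c p u"
    using v by (auto simp: tangent_space_def)
  obtain d where d: "d \<in> B" "F p \<in> fst d" by (rule smooth_atlas_cover[OF B])
  show ?thesis
    unfolding c(3) coord_vec_push[OF A B F(1) c(1,2) F(2) d] tangent_space_def using d by blast
qed

lemma smooth_map_on_ident:
  assumes "smooth_atlas A"
  shows "smooth_map_on A A UNIV (\<lambda>x. x)"
  using assms by (auto simp: smooth_map_on_def smooth_atlas_def vimage_def o_def)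

text \<open>A change of charts is the coordinate expression of the identity map, so
  \<open>coord_vec_push\<close> applies to it.\<close>

lemma tangent_space_chart:
  assumes A: "smooth_atlas A" and d: "d \<in> A" "p \<in> fst d"
  shows "tangent_space A p = range (coord_vec A d p)"
proof -
  have "coord_vec A c p u \<in> range (coord_vec A d p)" if "c \<in> A" "p \<in> fst c" for c u
  proof -
    have "coord_vec A c p u = differential A p (\<lambda>x. x) (coord_vec A c p u)"
      by (auto simp: differential_def coord_vec_def o_def)
    also have "\<dots> \<in> range (coord_vec A d p)"
      using coord_vec_push[OF A A smooth_map_on_ident[OF A] that _ d] by simp
    finally show ?thesis .
  qed
  then have "tangent_space A p \<subseteq> range (coord_vec A d p)"
    unfolding tangent_space_def by blast
  moreover have "range (coord_vec A d p) \<subseteq> tangent_space A p"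
    unfolding tangent_space_def using d by blast
  ultimately show ?thesis by (rule subset_antisym)
qed

lemma coord_vec_linear:
  assumes c: "c \<in> A" "p \<in> fst c"
  shows "coord_vec A c p (u + v) = (\<lambda>f. coord_vec A c p u f + coord_vec A c p v f)"
    and "coord_vec A c p (r *\<^sub>R u) = (\<lambda>f. r * coord_vec A c p u f)"
  using linear_frechet_derivative[OF differentiable_in_chart[OF _ c]]
  by (auto simp: coord_vec_def linear_add linear_scale fun_eq_iff)

text \<open>Tangent vectors depend on germs only. Besides the derivatives, the case distinction on
  \<open>smooth_at\<close> must be shown to be local.\<close>

lemma coord_vec_cong:
  assumes A: "smooth_atlas A" and c: "c \<in> A" "p \<in> fst c" and U: "open U" "p \<in> U"
    and eq: "\<And>x. x \<in> U \<Longrightarrow> f x = h x"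
  shows "coord_vec A c p u f = coord_vec A c p u h"
proof -
  have *: "smooth_at A p h" if sm: "smooth_at A p f" and eq: "\<And>x. x \<in> U \<Longrightarrow> f x = h x" for f h :: "'a \<Rightarrow> real"
  proof -
    obtain W where W: "p \<in> W" "smooth_map_on A std_atlas W f"
      using sm by (auto simp: smooth_at_def)
    have "open W" using W by (simp add: smooth_map_on_def)
    then have "smooth_map_on A std_atlas (W \<inter> U) h"
      using U(1) eq by (intro smooth_map_on_cong[OF _ _ W(2)])
        (auto simp: smooth_atlas_chart[OF A] std_atlas_open)
    moreover have "p \<in> W \<inter> U" using W(1) U(2) by simp
    ultimately show ?thesis unfolding smooth_at_def by (intro exI conjI)
  qed
  have iff: "smooth_at A p f \<longleftrightarrow> smooth_at A p h"
    using *[of f h] *[of h f] eq by auto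
  note ic = smooth_atlas_chart[OF A c(1)]
  have "frechet_derivative (f \<circ> chart_inv c) (at (snd c p)) = frechet_derivative (h \<circ> chart_inv c) (at (snd c p))"
    if "smooth_at A p f"
  proof (rule frechet_derivative_transform_within_open[OF differentiable_in_chart[OF that c]])
    show "open (snd c ` (fst c \<inter> U))"
      using ic U smooth_atlas_open[OF A c(1)] by (intro open_chart_image) auto
    show "snd c p \<in> snd c ` (fst c \<inter> U)" using c U by blast
  qed (use eq in \<open>auto simp: chart_inv_chart[OF ic]\<close>)
  then show ?thesis by (simp add: coord_vec_def iff)
qed

lemma tangent_cong:
  assumes A: "smooth_atlas A" and v: "v \<in> tangent_space A p" and U: "open U" "p \<in> U"
    and eq: "\<And>x. x \<in> U \<Longrightarrow> f x = h x"
  shows "v f = v h"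
proof -
  obtain c u where c: "c \<in> A" "p \<in> fst c" "v = coord_vec A c p u"
    using v by (auto simp: tangent_space_def)
  show ?thesis unfolding c(3) by (rule coord_vec_cong[OF A c(1,2) U eq])
qed

lemma smooth_map_on_compose_atlas:
  assumes "smooth_atlas A" "smooth_atlas B" "smooth_atlas C"
    and "smooth_map_on A B W F" "smooth_map_on B C W' G"
  shows "smooth_map_on A C (W \<inter> F -` W') (\<lambda>x. G (F x))"
  by (rule smooth_map_on_compose[OF _ assms(2) _ assms(4,5)])
    (simp_all add: smooth_atlas_chart[OF assms(1)] smooth_atlas_open[OF assms(3)])

section \<open>Homogeneous spaces\<close>

text \<open>Addition is restricted to the slice through \<open>a\<close>. In a product chart the
  slice is the affine map sending \<open>x\<close> to \<open>(snd c0 a, x)\<close>.\<close>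

lemma smooth_left_translation:
  fixes A :: "('g::{topological_group_add, t2_space, second_countable_topology}, 'd::euclidean_space) chart set"
  assumes "lie_group A"
  shows "smooth_map_on A A UNIV (\<lambda>b. a + b)"
  unfolding smooth_map_on_def
proof (intro conjI ballI)
  have at: "smooth_atlas A" and add: "smooth_map_on (prod_atlas A A) A UNIV (\<lambda>(a, b). a + b)"
    using assms by (auto simp: lie_group_def)
  show cont: "continuous_on UNIV (\<lambda>b. a + b)" by (intro continuous_intros)
  fix c d assume cd: "c \<in> A" "d \<in> A"
  obtain c0 where c0: "c0 \<in> A" "a \<in> fst c0" by (rule smooth_atlas_cover[OF at])
  note ic = smooth_atlas_chart[OF at cd(1)] and ic0 = smooth_atlas_chart[OF at c0(1)]
  let ?cc = "(fst c0 \<times> fst c, map_prod (snd c0) (snd c))"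
  let ?S = "snd c ` (fst c \<inter> UNIV \<inter> (\<lambda>b. a + b) -` fst d)"
  let ?T = "snd ?cc ` (fst ?cc \<inter> UNIV \<inter> (\<lambda>(a, b). a + b) -` fst d)"
  have "?cc \<in> prod_atlas A A" unfolding prod_atlas_def using cd c0 by blast
  then have T: "Ck_on k ?T (snd d \<circ> (\<lambda>(a, b). a + b) \<circ> chart_inv ?cc)" for k
    using smooth_map_on_Ck[OF add _ cd(2)] by blast
  have "open ((\<lambda>b. a + b) -` fst d)"
    using continuous_open_preimage[OF cont open_UNIV smooth_atlas_open[OF at cd(2)]] by simp
  then have oS: "open ?S"
    using smooth_atlas_open[OF at cd(1)] by (intro open_chart_image[OF ic]) auto
  have inj: "inj_on (snd c0) (fst c0)" "inj_on (snd c) (fst c)"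
    using chart_inv_chart[OF ic0] chart_inv_chart[OF ic] by (metis inj_onI)+
  have inv: "chart_inv ?cc (snd c0 a, snd c b) = (a, b)" if "b \<in> fst c" for b
  proof -
    have "inj_on (map_prod (snd c0) (snd c)) (fst c0 \<times> fst c)" using inj by (rule map_prod_inj_on)
    from inv_into_f_f[OF this, of "(a, b)"] show ?thesis using that c0 by (simp add: chart_inv_def)
  qed
  have "Ck_on k ?S (snd d \<circ> (\<lambda>b. a + b) \<circ> chart_inv c)" for k
  proof -
    have bl: "bounded_linear (\<lambda>x :: 'd. (0 :: 'd, x))"
      by (intro bounded_linear_Pair bounded_linear_zero bounded_linear_ident)
    have ident: "Ck_on k ?S (\<lambda>x. x)"
      by (induction k) (auto intro: Ck_on_const)
    have "Ck_on k ?S (\<lambda>x. (snd c0 a, 0) + (0, x))"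
      by (rule Ck_on_add[OF oS Ck_on_const Ck_on_bounded_linear[OF oS bl ident]])
    moreover have "(\<lambda>x. (snd c0 a, 0) + (0, x)) ` ?S \<subseteq> ?T"
    proof (clarsimp)
      fix b assume "b \<in> fst c" "a + b \<in> fst d"
      then have "(a, b) \<in> fst c0 \<times> fst c \<inter> (\<lambda>(x, y). x + y) -` fst d" using c0 by simp
      then show "(snd c0 a, snd c b) \<in> map_prod (snd c0) (snd c) ` (fst c0 \<times> fst c \<inter> (\<lambda>(x, y). x + y) -` fst d)"
        by (rule rev_image_eqI) simp
    qed
    ultimately have "Ck_on k ?S (\<lambda>x. (snd d \<circ> (\<lambda>(a, b). a + b) \<circ> chart_inv ?cc) ((snd c0 a, 0) + (0, x)))"
      using Ck_on_compose[OF oS _ _ T] by blast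
    then show ?thesis
      by (rule Ck_on_cong[OF oS]) (auto simp: inv chart_inv_chart[OF ic])
  qed
  with oS show "smooth_on ?S (snd d \<circ> (\<lambda>b. a + b) \<circ> chart_inv c)" by (simp add: smooth_on_def)
qed simp

text \<open>Inversion conjugates left translations into right translations.\<close>

lemma smooth_right_translation:
  fixes A :: "('g::{topological_group_add, t2_space, second_countable_topology}, 'd::euclidean_space) chart set"
  assumes "lie_group A"
  shows "smooth_map_on A A UNIV (\<lambda>b. b + a)"
proof -
  have at: "smooth_atlas A" and minus: "smooth_map_on A A UNIV uminus"
    using assms by (auto simp: lie_group_def)
  note comp = smooth_map_on_compose_atlas[OF at at at]
  have "smooth_map_on A A UNIV (\<lambda>b. - (- a + - b))"
    using comp[OF comp[OF minus smooth_left_translation[OF assms, of "- a"]] minus] by simp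
  then show ?thesis by (simp add: minus_add)
qed

section \<open>The projection onto the coset space\<close>

locale lie_homogeneous =
  fixes AG :: "('g::{topological_group_add, t2_space, second_countable_topology}, 'd::euclidean_space) chart set"
    and H :: "'g set"
    and AM :: "('m::{t2_space, second_countable_topology}, 'e::euclidean_space) chart set"
    and \<pi> :: "'g \<Rightarrow> 'm"
  assumes lie: "lie_group AG" and subgroup: "is_subgroup H" and homogeneous: "homogeneous_space AG H AM \<pi>"
begin

lemma atlas_G: "smooth_atlas AG"
  using lie by (simp add: lie_group_def)

lemma atlas_M: "smooth_atlas AM" and \<pi>_eq_iff: "\<pi> a = \<pi> b \<longleftrightarrow> - a + b \<in> H"
  and \<pi>_smooth: "smooth_map_on AG AM UNIV \<pi>" and \<pi>_inv: "\<pi> (inv \<pi> p) = p"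
  using homogeneous by (auto simp: homogeneous_space_def surj_f_inv_f)

lemma local_section:
  obtains W s where "p \<in> W" "smooth_map_on AM AG W s" "\<And>q. q \<in> W \<Longrightarrow> \<pi> (s q) = q"
  using homogeneous unfolding homogeneous_space_def by blast

text \<open>Frees \<open>translate\<close> from the representative picked by
  \<open>inv \<pi>\<close>: two representatives differ on the right by an element of
  \<open>H\<close>, and left translation preserves this.\<close>

lemma translate_\<pi>: "translate \<pi> a (\<pi> b) = \<pi> (a + b)"
proof -
  have "- (a + inv \<pi> (\<pi> b)) + (a + b) = - inv \<pi> (\<pi> b) + b"
    by (simp only: minus_add add.assoc minus_add_cancel)
  then show ?thesis
    using \<pi>_inv[of "\<pi> b"] unfolding translate_def \<pi>_eq_iff by simp
qed

text \<open>The representative \<open>inv \<pi> p\<close> need not vary smoothly with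
  \<open>p\<close>; near a given point it is exchanged for a smooth local section.\<close>

lemma smooth_translate:
  obtains W where "p \<in> W" "smooth_map_on AM AM W (translate \<pi> a)"
proof -
  obtain W s where W: "p \<in> W" "smooth_map_on AM AG W s" "\<And>q. q \<in> W \<Longrightarrow> \<pi> (s q) = q"
    using local_section[of p] by blast
  have "smooth_map_on AM AG W (\<lambda>q. a + s q)"
    using smooth_map_on_compose_atlas[OF atlas_M atlas_G atlas_G
        W(2) smooth_left_translation[OF lie, of a]] by simp
  from smooth_map_on_compose_atlas[OF atlas_M atlas_G atlas_M this \<pi>_smooth]
  have "smooth_map_on AM AM W (\<lambda>q. \<pi> (a + s q))" by simp
  then have "smooth_map_on AM AM W (translate \<pi> a)"
  proof (rule smooth_map_on_cong[rotated 2])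
    show "open W" using W(2) by (simp add: smooth_map_on_def)
    show "\<pi> (a + s q) = translate \<pi> a q" if "q \<in> W" for q
      using translate_\<pi>[of a "s q"] W(3)[OF that] by simp
  qed (simp_all add: smooth_atlas_chart[OF atlas_M] smooth_atlas_open[OF atlas_M])
  with W(1) show ?thesis by (rule that)
qed

lemma translate_push:
  assumes "u \<in> tangent_space AM p" "translate \<pi> a p = q"
  shows "differential AM q (translate \<pi> a) u \<in> tangent_space AM q"
proof -
  obtain W where W: "p \<in> W" "smooth_map_on AM AM W (translate \<pi> a)" by (rule smooth_translate)
  from tangent_push[OF atlas_M atlas_M W(2,1) assms(1)] show ?thesis by (simp add: assms(2))
qed

lemma projection_push:
  "v \<in> tangent_space AG 0 \<Longrightarrow> differential AM (\<pi> 0) \<pi> v \<in> tangent_space AM (\<pi> 0)"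
  using tangent_push[OF atlas_G atlas_M \<pi>_smooth] by simp

text \<open>A local section through the base point becomes a section through the identity after a right
  translation by an element of \<open>H\<close>; its differential is a right inverse.\<close>

lemma projection_surj:
  assumes w: "w \<in> tangent_space AM (\<pi> 0)"
  obtains v where "v \<in> tangent_space AG 0" "differential AM (\<pi> 0) \<pi> v = w"
proof -
  obtain W s where W: "\<pi> 0 \<in> W" "smooth_map_on AM AG W s" "\<And>q. q \<in> W \<Longrightarrow> \<pi> (s q) = q"
    using local_section[of "\<pi> 0"] by blast
  define s' where "s' q = s q - s (\<pi> 0)" for q
  have "\<pi> 0 = \<pi> (s (\<pi> 0))" using W(1,3) by simp
  then have "s (\<pi> 0) \<in> H" unfolding \<pi>_eq_iff by simp
  then have "\<pi> (s' q) = \<pi> (s q)" for q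
    unfolding \<pi>_eq_iff s'_def by (simp add: minus_diff_eq diff_add_eq add.assoc)
  with W(3) have \<pi>s': "\<pi> (s' q) = q" if "q \<in> W" for q using that by simp
  have s'0: "s' (\<pi> 0) = 0" by (simp add: s'_def)
  have sm: "smooth_map_on AM AG W s'"
    using smooth_map_on_compose_atlas[OF atlas_M atlas_G atlas_G
        W(2) smooth_right_translation[OF lie, of "- s (\<pi> 0)"]] by (simp add: s'_def[abs_def])
  define v where "v = differential AG 0 s' w"
  have "v \<in> tangent_space AG 0"
    using tangent_push[OF atlas_M atlas_G sm W(1) w] by (simp add: s'0 v_def)
  moreover have "differential AM (\<pi> 0) \<pi> v f = w f" for f
  proof (cases "smooth_at AM (\<pi> 0) f")
    case True
    then have "smooth_at AG 0 (f \<circ> \<pi>)"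
      using smooth_at_compose[OF atlas_G atlas_M \<pi>_smooth] by simp
    \<comment> \<open>\<open>\<pi> \<circ> s'\<close> is the identity on \<open>W\<close> only,
      which suffices because tangent vectors are local.\<close>
    moreover have "w (f \<circ> \<pi> \<circ> s') = w f"
    proof (rule tangent_cong[OF atlas_M w])
      show "open W" using W(2) by (simp add: smooth_map_on_def)
    qed (use W(1) \<pi>s' in auto)
    ultimately show ?thesis using True by (simp add: v_def differential_def)
  next
    case False
    then show ?thesis using w by (auto simp: differential_def tangent_space_def coord_vec_def)
  qed
  ultimately show ?thesis using that by blast
qed

text \<open>A curve inside \<open>H\<close> projects to a constant curve.\<close>

lemma projection_kernel:
  assumes "v \<in> lie_subgroup_algebra AG H"
  shows "differential AM (\<pi> 0) \<pi> v f = 0"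
proof -
  obtain c :: "real \<Rightarrow> 'g" where c: "range c \<subseteq> H"
    and v: "v = (\<lambda>f. if smooth_at AG 0 f then deriv (f \<circ> c) 0 else 0)"
    using assms by (auto simp: lie_subgroup_algebra_def)
  have "\<pi> (c t) = \<pi> 0" for t
    using c by (subst eq_commute) (auto simp: \<pi>_eq_iff)
  then have "f \<circ> \<pi> \<circ> c = (\<lambda>t. f (\<pi> 0))" by (simp add: fun_eq_iff)
  then show ?thesis by (simp add: v differential_def)
qed

end

locale sts_homogeneous = lie_homogeneous AG H AM \<pi> + nondegenerate_sts om tp
  for AG :: "('g::{topological_group_add, t2_space, second_countable_topology}, 'd::euclidean_space) chart set"
    and H and AM :: "('m::{t2_space, second_countable_topology}, 'e::euclidean_space) chart set"
    and \<pi> and om :: "'t::euclidean_space \<Rightarrow> 't \<Rightarrow> real" and tp +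
  fixes \<Phi> :: "'t envel \<Rightarrow> 'g tangent"
    and g :: "'m \<Rightarrow> 'm tangent \<Rightarrow> 'm tangent \<Rightarrow> real"
  assumes iso: "lie_pair_iso om tp AG H \<Phi>"
    and metric: "semi_riemannian_metric AM g"
    and invariant: "invariant_metric AM \<pi> g"
    and metric_sp: "\<gamma> \<in> spV \<Longrightarrow> \<gamma>' \<in> spV \<Longrightarrow>
      metric_at_o AM \<pi> \<Phi> g (\<gamma>, 0, 0) (\<gamma>', 0, 0) = - trace_sp \<gamma> \<gamma>' / 2"
    and metric_odd: "metric_at_o AM \<pi> \<Phi> g (0, 0, w) (0, 0, w') = om_V w w' / 2"
    and metric_mixed: "\<gamma> \<in> spV \<Longrightarrow> metric_at_o AM \<pi> \<Phi> g (\<gamma>, 0, 0) (0, 0, w) = 0"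
begin

section \<open>Identification of the complement of the inner derivations with the tangent
  space\<close>

abbreviation "base \<equiv> \<pi> 0"
abbreviation "go \<equiv> metric_at_o AM \<pi> \<Phi> g"
abbreviation "T \<equiv> to_tangent AM \<pi> \<Phi>"

lemma \<Phi>_bij: "bij_betw \<Phi> (envel_space tp) (tangent_space AG 0)"
  and \<Phi>_add: "X \<in> envel_space tp \<Longrightarrow> Y \<in> envel_space tp \<Longrightarrow> \<Phi> (X + Y) = (\<lambda>f. \<Phi> X f + \<Phi> Y f)"
  and \<Phi>_scale: "X \<in> envel_space tp \<Longrightarrow> \<Phi> (r *\<^sub>R X) = (\<lambda>f. r * \<Phi> X f)"
  and \<Phi>_h: "\<Phi> ` h_space tp = lie_subgroup_algebra AG H"
  using iso unfolding lie_pair_iso_def by blast+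

lemma T_add: "X \<in> envel_space tp \<Longrightarrow> Y \<in> envel_space tp \<Longrightarrow> T (X + Y) = (\<lambda>f. T X f + T Y f)"
  by (auto simp: to_tangent_def differential_def \<Phi>_add)

lemma T_scale: "X \<in> envel_space tp \<Longrightarrow> T (r *\<^sub>R X) = (\<lambda>f. r * T X f)"
  by (auto simp: to_tangent_def differential_def \<Phi>_scale)

lemma T_tangent: "X \<in> envel_space tp \<Longrightarrow> T X \<in> tangent_space AM base"
  unfolding to_tangent_def using \<Phi>_bij by (intro projection_push) (auto simp: bij_betw_def)

lemma T_h: "X \<in> h_space tp \<Longrightarrow> T X f = 0"
  unfolding to_tangent_def using \<Phi>_h by (intro projection_kernel) blast

text \<open>A preimage in the enveloping algebra may be projected to \<open>m_space\<close>, since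
  its other component is killed.\<close>

lemma T_surj:
  assumes "w \<in> tangent_space AM base"
  obtains X where "X \<in> m_space" "T X = w"
proof -
  obtain v where v: "v \<in> tangent_space AG 0" "differential AM base \<pi> v = w"
    using assms by (rule projection_surj)
  then obtain Z where Z: "Z \<in> envel_space tp" "\<Phi> Z = v"
    using \<Phi>_bij by (metis bij_betw_imp_surj_on imageE)
  have h: "proj_h Z \<in> envel_space tp" and m: "proj_m Z \<in> m_space"
    using Z(1) subspace_0[OF subspace_spV] by (auto simp: envel_space_def m_space_def)
  have "Z = proj_m Z + proj_h Z" by (cases Z) simp
  then have "T Z = (\<lambda>f. T (proj_m Z) f + T (proj_h Z) f)"
    using T_add[OF m_envel[OF m] h] by simp
  then have "T (proj_m Z) = w"
    using T_h[OF proj_h_in[OF Z(1)]] v(2) Z(2) by (simp add: to_tangent_def)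
  with m show ?thesis by (rule that)
qed

lemma metric_comp_facts:
  assumes "c \<in> AM" "p \<in> fst c"
  shows "bilinear (metric_comp AM g c p)"
    and "metric_comp AM g c p u v = metric_comp AM g c p v u"
    and "(\<And>v. metric_comp AM g c p u v = 0) \<Longrightarrow> u = 0"
  using metric assms unfolding semi_riemannian_metric_def by blast+

lemma metric_comp_cancel:
  assumes "c \<in> AM" "p \<in> fst c" "\<And>w. metric_comp AM g c p u w = metric_comp AM g c p v w"
  shows "u = v"
  using metric_comp_facts(3)[OF assms(1,2), of "u - v"]
    bilinear_lsub[OF metric_comp_facts(1)[OF assms(1,2)]] assms(3) by simp

text \<open>Coordinates that give the same functional have the same products with all vectors, so
  nondegeneracy of \<open>g\<close> in the chart identifies them.\<close>

lemma coord_vec_inj: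
  assumes "c \<in> AM" "p \<in> fst c"
  shows "inj (coord_vec AM c p)"
proof (rule injI)
  fix u v assume "coord_vec AM c p u = coord_vec AM c p v"
  then show "u = v" by (intro metric_comp_cancel[OF assms]) (simp add: metric_comp_def)
qed

definition co :: "('m, 'e) chart" where "co = (SOME c. c \<in> AM \<and> base \<in> fst c)"

lemma co: "co \<in> AM" "base \<in> fst co"
  using someI_ex[of "\<lambda>c. c \<in> AM \<and> base \<in> fst c"] smooth_atlas_cover[OF atlas_M, of base]
  unfolding co_def by blast+

text \<open>Carries \<open>m_space\<close> into the model space \<open>'e\<close>, where bilinearity
  and nondegeneracy of the metric are formulated.\<close>

definition \<xi> :: "'t envel \<Rightarrow> 'e" where "\<xi> X = inv (coord_vec AM co base) (T X)"

lemma coord_vec_\<xi>: "X \<in> m_space \<Longrightarrow> coord_vec AM co base (\<xi> X) = T X"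
  unfolding \<xi>_def using T_tangent[OF m_envel]
  by (intro f_inv_into_f) (simp add: tangent_space_chart[OF atlas_M co])

lemma lin_on_\<xi>: "lin_on m_space \<xi>"
  unfolding lin_on_def
proof (intro ballI allI)
  fix X Y :: "'t envel" and r s assume XY: "X \<in> m_space" "Y \<in> m_space"
  have m: "r *\<^sub>R X \<in> m_space" "s *\<^sub>R Y \<in> m_space" "r *\<^sub>R X + s *\<^sub>R Y \<in> m_space"
    using XY by (simp_all add: subspace_add[OF subspace_m] subspace_mul[OF subspace_m])
  have "coord_vec AM co base (\<xi> (r *\<^sub>R X + s *\<^sub>R Y)) = coord_vec AM co base (r *\<^sub>R \<xi> X + s *\<^sub>R \<xi> Y)"
    unfolding coord_vec_\<xi>[OF m(3)] coord_vec_linear[OF co] coord_vec_\<xi>[OF XY(1)] coord_vec_\<xi>[OF XY(2)]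
      T_add[OF m_envel[OF m(1)] m_envel[OF m(2)]] T_scale[OF m_envel[OF XY(1)]] T_scale[OF m_envel[OF XY(2)]] ..
  then show "\<xi> (r *\<^sub>R X + s *\<^sub>R Y) = r *\<^sub>R \<xi> X + s *\<^sub>R \<xi> Y"
    using coord_vec_inj[OF co] by (simp add: inj_eq)
qed

lemma go_\<xi>: "X \<in> m_space \<Longrightarrow> Y \<in> m_space \<Longrightarrow> go X Y = metric_comp AM g co base (\<xi> X) (\<xi> Y)"
  by (simp add: metric_at_o_def metric_comp_def coord_vec_\<xi>)

text \<open>The prescribed blocks determine the form by bilinearity in the coordinates
  \<open>\<xi>\<close>; the second mixed block follows from the first by symmetry.\<close>

lemma go_eq_metric_form:
  assumes "X \<in> m_space" "Y \<in> m_space"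
  shows "go X Y = metric_form X Y"
proof -
  obtain \<gamma> w \<gamma>' w' where XY: "X = (\<gamma>, 0, w)" "Y = (\<gamma>', 0, w')" and sp: "\<gamma> \<in> spV" "\<gamma>' \<in> spV"
    using assms by (auto simp: m_space_def)
  have m: "(\<gamma>, 0, 0) \<in> m_space" "(0, 0, w) \<in> m_space" if "\<gamma> \<in> spV" for \<gamma> and w :: "'t^2"
    using that subspace_0[OF subspace_spV] by (auto simp: m_space_def)
  have split: "\<xi> (\<gamma>, 0, w) = \<xi> (\<gamma>, 0, 0) + \<xi> (0, 0, w)" if "\<gamma> \<in> spV" for \<gamma> w
    using lin_on_\<xi>[unfolded lin_on_def, rule_format, OF m[OF that], of 1 1 w] by simp
  have "go X Y = go (\<gamma>, 0, 0) (\<gamma>', 0, 0) + go (0, 0, w) (0, 0, w')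
      + go (\<gamma>, 0, 0) (0, 0, w') + go (\<gamma>', 0, 0) (0, 0, w)"
    unfolding XY go_\<xi>[OF assms, unfolded XY] go_\<xi>[OF m(1)[OF sp(1)] m(1)[OF sp(2)]] go_\<xi>[OF m(2) m(2), OF sp(1) sp(1)]
      go_\<xi>[OF m(1) m(2), OF sp(1) sp(1)] go_\<xi>[OF m(1) m(2), OF sp(2) sp(1)]
      split[OF sp(1), of w] split[OF sp(2), of w']
      bilinear_ladd[OF metric_comp_facts(1)[OF co]] bilinear_radd[OF metric_comp_facts(1)[OF co]]
    using metric_comp_facts(2)[OF co, of "\<xi> (\<gamma>', 0, 0)" "\<xi> (0, 0, w)"] by linarith
  then show ?thesis using sp by (simp add: XY metric_sp metric_odd metric_mixed)
qed

text \<open>The kernel of the differential of \<open>\<pi>\<close> need not be known to equal the Lie algebra of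
  \<open>H\<close>: a vector of \<open>\<mm>\<close> in that kernel is orthogonal to \<open>\<mm>\<close>, hence zero.\<close>

lemma \<xi>_inj: "inj_on \<xi> m_space"
proof (rule inj_onI)
  fix X Y :: "'t envel" assume XY: "X \<in> m_space" "Y \<in> m_space" "\<xi> X = \<xi> Y"
  then have "metric_form (X - Y) Z = 0" if "Z \<in> m_space" for Z
    using that by (simp add: go_eq_metric_form[symmetric] go_\<xi> bilinear_lsub[OF metric_form_bilinear])
  then show "X = Y"
    using metric_form_nondegenerate[of "X - Y"] XY by (simp add: subspace_diff[OF subspace_m])
qed

lemma \<xi>_surj: "\<xi> ` m_space = UNIV"
proof -
  have "u \<in> \<xi> ` m_space" for u
  proof -
    have "coord_vec AM co base u \<in> tangent_space AM base" by (simp add: tangent_space_chart[OF atlas_M co])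
    then obtain X where X: "X \<in> m_space" "T X = coord_vec AM co base u" by (rule T_surj)
    then have "\<xi> X = u" using coord_vec_inj[OF co] by (simp add: \<xi>_def)
    with X(1) show ?thesis by blast
  qed
  then show ?thesis by blast
qed

lemma T_bij: "bij_betw T m_space (tangent_space AM base)"
proof -
  have "inj_on T m_space"
    using \<xi>_inj by (auto simp: inj_on_def \<xi>_def)
  moreover have "T ` m_space = tangent_space AM base"
    using T_tangent[OF m_envel] T_surj by blast
  ultimately show ?thesis by (simp add: bij_betw_def)
qed

text \<open>The dimension is found by computing the trace of the identity of the complement in two ways.\<close>

lemma dim_M: "DIM('e) = 2 * DIM('t) + 3"
proof -
  define \<eta> where "\<eta> = inv_into m_space \<xi>"
  have \<eta>: "\<eta> u \<in> m_space" "\<xi> (\<eta> u) = u" for u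
    unfolding \<eta>_def using \<xi>_surj by (auto intro: inv_into_into f_inv_into_f)
  have "(\<Sum>b\<in>Basis. (\<xi> X \<bullet> b) *\<^sub>R \<eta> b) = X" if X: "X \<in> m_space" for X
  proof (rule inj_onD[OF \<xi>_inj _ _ X])
    show "(\<Sum>b\<in>Basis. (\<xi> X \<bullet> b) *\<^sub>R \<eta> b) \<in> m_space"
      using \<eta> by (intro subspace_sum[OF subspace_m] subspace_mul[OF subspace_m])
    show "\<xi> (\<Sum>b\<in>Basis. (\<xi> X \<bullet> b) *\<^sub>R \<eta> b) = \<xi> X"
      using lin_on_sum[OF subspace_m lin_on_\<xi> finite_Basis \<eta>(1), of "\<lambda>b. \<xi> X \<bullet> b" "\<lambda>b. b"]
      by (simp add: \<eta> euclidean_representation)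
  qed
  then have "frame m_space Basis \<eta> (\<lambda>b X. \<xi> X \<bullet> b)"
    using lin_on_\<xi> by (simp add: frame_def subspace_m \<eta> lin_on_def inner_add_left)
  from trace_on_frame[OF this lin_on_linear[OF linear_id]]
  have "trace_on m_space (\<lambda>X :: 't envel. X) = DIM('e)" by (simp add: \<eta> id_def)
  moreover have "trace_on m_space (\<lambda>X :: 't envel. X) = 3 + 2 * DIM('t)"
    by (subst trace_on_m) (simp_all add: linear_ident trace_on_spV entry_sp_basis tr_simps)
  ultimately show ?thesis by linarith
qed

text \<open>Both tensors are read at the base point after the same translation. Invariance of
  \<open>g\<close> returns to \<open>p\<close>, and \<open>dim_M\<close> turns the constant
  \<open>2 * DIM('t) + 2\<close> into dim M - 1.\<close>

lemma ricci_tensor_eq: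
  assumes uv: "u \<in> tangent_space AM p" "v \<in> tangent_space AM p"
  shows "ricci_tensor AM \<pi> \<Phi> om tp g p u v = (real DIM('e) - 1) * g p u v"
proof -
  define F where "F = translate \<pi> (- inv \<pi> p)"
  define pull where "pull w = inv_into m_space T (differential AM base F w)" for w
  have Fp: "F p = base"
    using translate_\<pi>[of "- inv \<pi> p" "inv \<pi> p"] by (simp add: F_def \<pi>_inv)
  have pull: "pull w \<in> m_space" "T (pull w) = differential AM base F w" if "w \<in> tangent_space AM p" for w
    unfolding pull_def
    using translate_push[OF that Fp[unfolded F_def]] T_bij
    by (auto simp: F_def bij_betw_def intro: inv_into_into f_inv_into_f)
  have "ricci_tensor AM \<pi> \<Phi> om tp g p u v = ricci_o om tp go (pull u) (pull v)"
    by (simp add: ricci_tensor_def pull_def F_def)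
  also have "\<dots> = (2 * DIM('t) + 2) * go (pull u) (pull v)"
    using ricci_eq[OF go_eq_metric_form pull(1)[OF uv(1)] pull(1)[OF uv(2)]] go_eq_metric_form pull(1) uv by simp
  also have "go (pull u) (pull v) = g p u v"
  proof -
    have "g (F p) (differential AM (F p) F u) (differential AM (F p) F v) = g p u v"
      using invariant uv unfolding invariant_metric_def F_def by blast
    then show ?thesis by (simp add: metric_at_o_def pull uv Fp)
  qed
  finally show ?thesis by (simp add: dim_M)
qed

lemma scalar_curvature_eq:
  "scalar_curvature AM \<pi> \<Phi> om tp g p = (real DIM('e) - 1) * real DIM('e)"
proof -
  define c where "c = (SOME c. c \<in> AM \<and> p \<in> fst c)"
  have c: "c \<in> AM" "p \<in> fst c"
    using someI_ex[of "\<lambda>c. c \<in> AM \<and> p \<in> fst c"] smooth_atlas_cover[OF atlas_M, of p]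
    unfolding c_def by blast+
  let ?k = "real DIM('e) - 1"
  have Rc: "metric_comp AM (ricci_tensor AM \<pi> \<Phi> om tp g) c p u v = ?k * metric_comp AM g c p u v" for u v
    by (simp add: metric_comp_def ricci_tensor_eq tangent_space_chart[OF atlas_M c])
  have lin: "linear (\<lambda>u :: 'e. ?k *\<^sub>R u)" by (rule linear_scaleR)
  \<comment> \<open>The Einstein equation exhibits a multiple of the identity as a solution;
    nondegeneracy makes it the only one.\<close>
  have "(THE Q. linear Q \<and> (\<forall>u v. metric_comp AM g c p (Q u) v
      = metric_comp AM (ricci_tensor AM \<pi> \<Phi> om tp g) c p u v)) = (\<lambda>u. ?k *\<^sub>R u)"
  proof (rule the_equality)
    show "linear (\<lambda>u. ?k *\<^sub>R u) \<and> (\<forall>u v. metric_comp AM g c p (?k *\<^sub>R u) v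
      = metric_comp AM (ricci_tensor AM \<pi> \<Phi> om tp g) c p u v)"
      using lin by (simp add: Rc bilinear_lmul[OF metric_comp_facts(1)[OF c]])
  next
    fix Q assume "linear Q \<and> (\<forall>u v. metric_comp AM g c p (Q u) v
      = metric_comp AM (ricci_tensor AM \<pi> \<Phi> om tp g) c p u v)"
    then show "Q = (\<lambda>u. ?k *\<^sub>R u)"
      by (intro ext metric_comp_cancel[OF c]) (simp add: Rc bilinear_lmul[OF metric_comp_facts(1)[OF c]])
  qed
  then show ?thesis
    unfolding scalar_curvature_def metric_trace_def c_def[symmetric] Let_def
    by (simp only: trace_on_UNIV[OF lin]) (simp only: tr_simps)
qed

end

theorem corollary3p3:
  fixes om :: "'t::euclidean_space \<Rightarrow> 't \<Rightarrow> real"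
    and tp :: "'t \<Rightarrow> 't \<Rightarrow> 't \<Rightarrow> 't"
    and n :: nat
    and AG :: "('g::{topological_group_add, t2_space, second_countable_topology},
                'd::euclidean_space) chart set"
    and H :: "'g set"
    and AM :: "('m::{t2_space, second_countable_topology}, 'e::euclidean_space) chart set"
    and \<pi> :: "'g \<Rightarrow> 'm"
    and \<Phi> :: "'t envel \<Rightarrow> 'g tangent"
    and g :: "'m \<Rightarrow> 'm tangent \<Rightarrow> 'm tangent \<Rightarrow> real"
  assumes "simple_sts om tp"
    and "DIM('t) = 2 * n"
    and "lie_group AG"
    and "is_subgroup H" and "closed H" and "connected H"
    and "lie_pair_iso om tp AG H \<Phi>"
    and "homogeneous_space AG H AM \<pi>"
    and "semi_riemannian_metric AM g"
    and "invariant_metric AM \<pi> g"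
    and "\<And>\<gamma> \<gamma>'. \<gamma> \<in> spV \<Longrightarrow> \<gamma>' \<in> spV \<Longrightarrow>
      metric_at_o AM \<pi> \<Phi> g (\<gamma>, 0, 0) (\<gamma>', 0, 0)
        = - (1 / (4 * (real n + 2))) * killing om tp (\<gamma>, 0, 0) (\<gamma>', 0, 0)"
    and "\<And>w w'. metric_at_o AM \<pi> \<Phi> g (0, 0, w) (0, 0, w')
        = - (1 / (8 * (real n + 2))) * killing om tp (0, 0, w) (0, 0, w')"
    and "\<And>\<gamma> w. \<gamma> \<in> spV \<Longrightarrow> metric_at_o AM \<pi> \<Phi> g (\<gamma>, 0, 0) (0, 0, w) = 0"
  shows "einstein AM g (ricci_tensor AM \<pi> \<Phi> om tp g)
    \<and> (\<forall>X\<in>m_space. \<forall>Y\<in>m_space. ricci_o om tp (metric_at_o AM \<pi> \<Phi> g) X Y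
           = (real DIM('e) - 1) * metric_at_o AM \<pi> \<Phi> g X Y)
    \<and> (\<forall>p. 0 < scalar_curvature AM \<pi> \<Phi> om tp g p
           \<and> scalar_curvature AM \<pi> \<Phi> om tp g p = (real DIM('e) - 1) * real DIM('e))"
proof -
  interpret symplectic_triple_system om tp using assms(1) by (simp add: simple_sts_def)
  have ideals: "\<And>I. sts_ideal tp I \<Longrightarrow> I = {0} \<or> I = UNIV"
    using assms(1) unfolding simple_sts_def by blast
  interpret nondegenerate_sts om tp
    by unfold_locales (rule om_nondegenerate_of_simple[OF ideals])
  have n: "real n + 2 \<noteq> 0" by linarith
  interpret sts_homogeneous AG H AM \<pi> om tp \<Phi> g
  proof unfold_locales
    show "metric_at_o AM \<pi> \<Phi> g (\<gamma>, 0, 0) (\<gamma>', 0, 0) = - trace_sp \<gamma> \<gamma>' / 2"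
      if "\<gamma> \<in> spV" "\<gamma>' \<in> spV" for \<gamma> \<gamma>'
    proof -
      \<comment> \<open>The Killing factor 2(n+2) cancels against 4(n+2), leaving -1/2.\<close>
      have "real (4 + DIM('t)) = 2 * (real n + 2)" using assms(2) by simp
      with n show ?thesis unfolding assms(11)[OF that] killing_sp[OF that] by (simp add: field_simps)
    qed
    show "metric_at_o AM \<pi> \<Phi> g (0, 0, w) (0, 0, w') = om_V w w' / 2" for w w'
    proof -
      \<comment> \<open>The Killing factor is -4(n+2); against -1/(8(n+2)) it leaves 1/2.\<close>
      have "real (DIM('t) + 4) = 2 * (real n + 2)" using assms(2) by simp
      with n show ?thesis unfolding assms(12) killing_odd by (simp add: field_simps)
    qed
  qed (fact assms)+
  have "ricci_o om tp go X Y = (real DIM('e) - 1) * go X Y" if "X \<in> m_space" "Y \<in> m_space" for X Y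
    using ricci_eq[OF go_eq_metric_form that] go_eq_metric_form[OF that] by (simp add: dim_M)
  moreover have "einstein AM g (ricci_tensor AM \<pi> \<Phi> om tp g)"
    unfolding einstein_def using ricci_tensor_eq by blast
  moreover have "0 < (real DIM('e) - 1) * real DIM('e)" by (simp add: dim_M)
  ultimately show ?thesis by (simp add: scalar_curvature_eq)
qed

end
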